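(* Let $S_1$ be the backward shift on $L^2(0,\infty)$ given by $(S_1 f)(t) = f(t+1)$ for almost every $t \ge 0$, and let $(U_t)_{t \ge 0}$ be the $C_0$-semigroup on $L^2(0,\infty)$ whose cogenerator is $S_1$. Then for every $C_{0.}$ contraction semigroup $(T(t))_{t \ge 0}$ on a separable infinite-dimensional Hilbert space $\mathcal{K}$ there are a closed subspace $\mathcal{M}$ of $L^2(0,\infty)$ invariant for every $U_t$, $t \ge 0$, and a bounded linear isomorphism $R : \mathcal{M} \to \mathcal{K}$ such that $$T(t) = R\, (U_t)_{|\mathcal{M}}\, R^{-1} \quad \text{for all } t \ge 0.$$
   Context: All Hilbert spaces are complex. A $C_0$-semigroup is a strongly continuous one-parameter semigroup $(T_t)_{t\ge0}$ of bounded operators, with generator $A$. If $1$ is not in the spectrum of $A$, the cogenerator of the semigroup is the bounded operator $V = (A+\mathrm{Id})(A-\mathrm{Id})^{-1}$. A bounded operator $V$ is the cogenerator of a $C_0$-semigroup of contractions if and only if $V$ is a contraction and $1$ is not an eigenvalue of $V$. An operator $T$ is of class $C_{0.}$ if $\|T^n x\| \to 0$ as $n \to \infty$ for all $x$. A $C_{0.}$ contraction semigroup is a $C_0$-semigroup $(T(t))_{t\ge 0}$ of contractions such that $\|T(t)x\| \to 0$ as $t \to \infty$ for every $x$. *)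

theory Defs
  imports "HOL-Analysis.Analysis"
begin

section \<open>Complex Hilbert spaces\<close>

text \<open>
  The inner product is linear in the first and conjugate-linear in the second argument. The class
  extends the real inner product spaces of the library, so that norm, topology and completeness
  are the library's: the real inner product is the real part of the complex one, hence
  \<open>cinner x x = (norm x)\<^sup>2\<close> (lemma \<open>cinner_self\<close>).
\<close>

class complex_hilbert_space = real_inner + banach +
  fixes scaleC :: "complex \<Rightarrow> 'a \<Rightarrow> 'a"  (infixr "*\<^sub>C" 75)
    and cinner :: "'a \<Rightarrow> 'a \<Rightarrow> complex"
  assumes scaleC_add_right: "a *\<^sub>C (x + y) = a *\<^sub>C x + a *\<^sub>C y"
    and scaleC_add_left: "(a + b) *\<^sub>C x = a *\<^sub>C x + b *\<^sub>C x"
    and scaleC_scaleC: "a *\<^sub>C b *\<^sub>C x = (a * b) *\<^sub>C x"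
    and scaleC_of_real: "complex_of_real r *\<^sub>C x = r *\<^sub>R x"
    and cinner_commute: "cinner x y = cnj (cinner y x)"
    and cinner_add_left: "cinner (x + y) z = cinner x z + cinner y z"
    and cinner_scaleC_left: "cinner (a *\<^sub>C x) y = a * cinner x y"
    and inner_eq_Re_cinner: "inner x y = Re (cinner x y)"

lemma cinner_self:
  fixes x :: "'a::complex_hilbert_space"
  shows "cinner x x = complex_of_real ((norm x)\<^sup>2)"
proof -
  have "Im (cinner x x) = 0"
    using arg_cong[OF cinner_commute[of x x], of Im] by simp
  then show ?thesis
    by (simp add: complex_eq_iff power2_norm_eq_inner inner_eq_Re_cinner)
qed

global_interpretation complex_vector:
  vector_space "scaleC :: complex \<Rightarrow> 'a \<Rightarrow> 'a::complex_hilbert_space"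
proof unfold_locales
  show "1 *\<^sub>C x = x" for x :: 'a
    using scaleC_of_real[of 1 x] by simp
qed (simp_all add: scaleC_add_right scaleC_add_left scaleC_scaleC)

definition infinite_dimensional :: "'a::complex_hilbert_space itself \<Rightarrow> bool" where
  "infinite_dimensional _ \<longleftrightarrow> \<not> (\<exists>B :: 'a set. finite B \<and> complex_vector.span B = UNIV)"


section \<open>Bounded linear maps\<close>

definition bounded_clinear_on ::
  "'a::complex_hilbert_space set \<Rightarrow> ('a \<Rightarrow> 'b::complex_hilbert_space) \<Rightarrow> bool" where
  "bounded_clinear_on S F \<longleftrightarrow>
     (\<forall>x\<in>S. \<forall>y\<in>S. F (x + y) = F x + F y) \<and>
     (\<forall>c. \<forall>x\<in>S. F (c *\<^sub>C x) = c *\<^sub>C F x) \<and>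
     (\<exists>K. \<forall>x\<in>S. norm (F x) \<le> K * norm x)"

abbreviation bounded_clinear ::
  "('a::complex_hilbert_space \<Rightarrow> 'b::complex_hilbert_space) \<Rightarrow> bool" where
  "bounded_clinear \<equiv> bounded_clinear_on UNIV"

definition bounded_linear_isomorphism ::
  "'a::complex_hilbert_space set \<Rightarrow> 'b::complex_hilbert_space set \<Rightarrow> ('a \<Rightarrow> 'b) \<Rightarrow> bool" where
  "bounded_linear_isomorphism M N R \<longleftrightarrow>
     bij_betw R M N \<and> bounded_clinear_on M R \<and> bounded_clinear_on N (inv_into M R)"


section \<open>Semigroups, generators and cogenerators\<close>

definition C0_semigroup :: "(real \<Rightarrow> 'a \<Rightarrow> 'a::complex_hilbert_space) \<Rightarrow> bool" where
  "C0_semigroup T \<longleftrightarrow>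
     (\<forall>t\<ge>0. bounded_clinear (T t)) \<and>
     T 0 = id \<and>
     (\<forall>s\<ge>0. \<forall>t\<ge>0. T (s + t) = T s \<circ> T t) \<and>
     (\<forall>x. continuous_on {0..} (\<lambda>t. T t x))"

definition generator_domain :: "(real \<Rightarrow> 'a \<Rightarrow> 'a::complex_hilbert_space) \<Rightarrow> 'a set" where
  "generator_domain T = {x. \<exists>y. ((\<lambda>h. (T h x - x) /\<^sub>R h) \<longlongrightarrow> y) (at_right 0)}"

text \<open>Only meaningful on \<^const>\<open>generator_domain\<close>.\<close>

definition generator :: "(real \<Rightarrow> 'a \<Rightarrow> 'a::complex_hilbert_space) \<Rightarrow> 'a \<Rightarrow> 'a" where
  "generator T x = Lim (at_right 0) (\<lambda>h. (T h x - x) /\<^sub>R h)"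

text \<open>An unbounded operator is given by its domain \<open>D\<close> and its action \<open>A\<close> on \<open>D\<close>.\<close>

definition op_resolvent_set ::
  "'a::complex_hilbert_space set \<Rightarrow> ('a \<Rightarrow> 'a) \<Rightarrow> complex set" where
  "op_resolvent_set D A =
     {z. bij_betw (\<lambda>x. A x - z *\<^sub>C x) D UNIV \<and>
         bounded_clinear (inv_into D (\<lambda>x. A x - z *\<^sub>C x))}"

definition op_spectrum ::
  "'a::complex_hilbert_space set \<Rightarrow> ('a \<Rightarrow> 'a) \<Rightarrow> complex set" where
  "op_spectrum D A = - op_resolvent_set D A"

definition cogenerator :: "(real \<Rightarrow> 'a \<Rightarrow> 'a::complex_hilbert_space) \<Rightarrow> 'a \<Rightarrow> 'a" where
  "cogenerator T =
     (\<lambda>x. generator T x + x) \<circ> inv_into (generator_domain T) (\<lambda>x. generator T x - x)"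

text \<open>The cogenerator exists only if \<open>1\<close> is not in the spectrum of the generator.\<close>

definition has_cogenerator ::
  "(real \<Rightarrow> 'a \<Rightarrow> 'a::complex_hilbert_space) \<Rightarrow> ('a \<Rightarrow> 'a) \<Rightarrow> bool" where
  "has_cogenerator T V \<longleftrightarrow>
     1 \<notin> op_spectrum (generator_domain T) (generator T) \<and> cogenerator T = V"

definition C0_dot_contraction_semigroup ::
  "(real \<Rightarrow> 'a \<Rightarrow> 'a::complex_hilbert_space) \<Rightarrow> bool" where
  "C0_dot_contraction_semigroup T \<longleftrightarrow>
     C0_semigroup T \<and>
     (\<forall>t\<ge>0. \<forall>x. norm (T t x) \<le> norm x) \<and>
     (\<forall>x. ((\<lambda>t. norm (T t x)) \<longlongrightarrow> 0) at_top)"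


section \<open>The Hilbert space $L^2(0,\infty)$\<close>

abbreviation half_line :: "real measure" where
  "half_line \<equiv> lebesgue_on {0<..}"

definition square_integrable :: "'a measure \<Rightarrow> ('a \<Rightarrow> complex) \<Rightarrow> bool" where
  "square_integrable M f \<longleftrightarrow> f \<in> borel_measurable M \<and> integrable M (\<lambda>t. (cmod (f t))\<^sup>2)"

lemma square_integrable_measurable [measurable_dest]:
  "square_integrable M f \<Longrightarrow> f \<in> borel_measurable M"
  by (simp add: square_integrable_def)

lemma square_integrable_cong_AE:
  assumes "square_integrable M f" "g \<in> borel_measurable M" "AE t in M. f t = g t"
  shows "square_integrable M g"
proof -
  have "integrable M (\<lambda>t. (cmod (f t))\<^sup>2) \<longleftrightarrow> integrable M (\<lambda>t. (cmod (g t))\<^sup>2)"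
    by (rule integrable_cong_AE) (use assms in \<open>auto simp: square_integrable_def\<close>)
  with assms show ?thesis by (simp add: square_integrable_def)
qed

lemma square_integrable_zero: "square_integrable M (\<lambda>_. 0)"
  by (simp add: square_integrable_def)

lemma square_integrable_scale:
  "square_integrable M f \<Longrightarrow> square_integrable M (\<lambda>t. c * f t)"
  by (auto simp: square_integrable_def norm_mult power_mult_distrib)

lemma square_integrable_add:
  assumes "square_integrable M f" "square_integrable M g"
  shows "square_integrable M (\<lambda>t. f t + g t)"
proof -
  have [measurable]: "f \<in> borel_measurable M" "g \<in> borel_measurable M"
    using assms by (auto simp: square_integrable_def)
  have le: "(cmod (a + b))\<^sup>2 \<le> 2 * (cmod a)\<^sup>2 + 2 * (cmod b)\<^sup>2" for a b
  proof -
    have "(cmod (a + b))\<^sup>2 \<le> (cmod a + cmod b)\<^sup>2"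
      by (intro power_mono norm_triangle_ineq) auto
    also have "\<dots> \<le> 2 * (cmod a)\<^sup>2 + 2 * (cmod b)\<^sup>2"
      using zero_le_power2[of "cmod a - cmod b"] by (simp add: power2_sum power2_diff)
    finally show ?thesis .
  qed
  have "integrable M (\<lambda>t. (cmod (f t + g t))\<^sup>2)"
    by (rule Bochner_Integration.integrable_bound
          [of M "\<lambda>t. 2 * (cmod (f t))\<^sup>2 + 2 * (cmod (g t))\<^sup>2"])
       (use assms le in \<open>simp_all add: square_integrable_def\<close>)
  then show ?thesis by (simp add: square_integrable_def)
qed

lemma square_integrable_diff:
  "square_integrable M f \<Longrightarrow> square_integrable M g \<Longrightarrow> square_integrable M (\<lambda>t. f t - g t)"
  using square_integrable_add[of M f "\<lambda>t. (-1) * g t"] square_integrable_scale[of M g "-1"]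
  by simp

lemma borel_measurable_mult_cnj:
  assumes "f \<in> borel_measurable M" "g \<in> borel_measurable M"
  shows "(\<lambda>t. f t * cnj (g t)) \<in> borel_measurable M"
proof -
  have "cnj \<in> borel_measurable borel"
    by (intro borel_measurable_continuous_onI continuous_intros)
  then show ?thesis
    using assms by measurable
qed

lemma integrable_mult_cnj:
  assumes "square_integrable M f" "square_integrable M g"
  shows "integrable M (\<lambda>t. f t * cnj (g t))"
proof -
  have [measurable]: "f \<in> borel_measurable M" "g \<in> borel_measurable M"
    using assms by (auto simp: square_integrable_def)
  have le: "cmod a * cmod b \<le> (cmod a)\<^sup>2 + (cmod b)\<^sup>2" for a b
  proof -
    have "2 * (cmod a * cmod b) \<le> (cmod a)\<^sup>2 + (cmod b)\<^sup>2"
      using zero_le_power2[of "cmod a - cmod b"] by (simp add: power2_diff)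
    moreover have "0 \<le> cmod a * cmod b" by simp
    ultimately show ?thesis by linarith
  qed
  show ?thesis
    by (rule Bochner_Integration.integrable_bound
          [of M "\<lambda>t. (cmod (f t))\<^sup>2 + (cmod (g t))\<^sup>2"])
       (use assms le in \<open>simp_all add: square_integrable_def norm_mult borel_measurable_mult_cnj\<close>)
qed

lemma integrable_inner:
  assumes "square_integrable M f" "square_integrable M g"
  shows "integrable M (\<lambda>t. inner (f t) (g t))"
  using integrable_Re[OF integrable_mult_cnj[OF assms]] by (simp add: inner_complex_def)

definition L2_rel :: "(real \<Rightarrow> complex) \<Rightarrow> (real \<Rightarrow> complex) \<Rightarrow> bool" where
  "L2_rel f g \<longleftrightarrow> square_integrable half_line f \<and> square_integrable half_line g \<and>
     (AE t in half_line. f t = g t)"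

quotient_type L2_half_line = "real \<Rightarrow> complex" / partial: L2_rel
proof (rule part_equivpI)
  show "\<exists>f. L2_rel f f"
    by (auto simp: L2_rel_def intro: square_integrable_zero)
  show "symp L2_rel"
    by (auto simp: symp_def L2_rel_def)
  show "transp L2_rel"
    by (auto simp: transp_def L2_rel_def elim: eventually_elim2)
qed

instantiation L2_half_line :: real_vector
begin

lift_definition zero_L2_half_line :: L2_half_line is "\<lambda>_. 0"
  by (simp add: L2_rel_def square_integrable_zero)

lift_definition plus_L2_half_line :: "L2_half_line \<Rightarrow> L2_half_line \<Rightarrow> L2_half_line"
  is "\<lambda>f g t. f t + g t"
  by (auto simp: L2_rel_def square_integrable_add elim: eventually_elim2)

lift_definition minus_L2_half_line :: "L2_half_line \<Rightarrow> L2_half_line \<Rightarrow> L2_half_line"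
  is "\<lambda>f g t. f t - g t"
  by (auto simp: L2_rel_def square_integrable_diff elim: eventually_elim2)

lift_definition uminus_L2_half_line :: "L2_half_line \<Rightarrow> L2_half_line" is "\<lambda>f t. - f t"
  using square_integrable_scale[of half_line _ "-1"] by (auto simp: L2_rel_def)

lift_definition scaleR_L2_half_line :: "real \<Rightarrow> L2_half_line \<Rightarrow> L2_half_line"
  is "\<lambda>r f t. r *\<^sub>R f t"
  using square_integrable_scale[of half_line] by (auto simp: L2_rel_def scaleR_conv_of_real)

instance
proof
  fix f g h :: L2_half_line and r s :: real
  note sq = square_integrable_zero square_integrable_add square_integrable_diff
    square_integrable_scale
  have sqR: "square_integrable half_line f \<Longrightarrow> square_integrable half_line (\<lambda>t. r *\<^sub>R f t)"
    "square_integrable half_line f \<Longrightarrow> square_integrable half_line (\<lambda>t. - f t)" for f r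
    using sq(4)[of half_line f "complex_of_real r"] sq(4)[of half_line f "-1"]
    by (simp_all add: scaleR_conv_of_real)
  show "f + g + h = f + (g + h)"
    by transfer (auto simp: L2_rel_def algebra_simps intro!: sq)
  show "f + g = g + f"
    by transfer (auto simp: L2_rel_def algebra_simps intro!: sq)
  show "0 + f = f"
    by transfer (auto simp: L2_rel_def)
  show "- f + f = 0"
    by transfer (auto simp: L2_rel_def intro!: sq)
  show "f - g = f + - g"
    by transfer (auto simp: L2_rel_def intro!: sq sqR)
  show "r *\<^sub>R (f + g) = r *\<^sub>R f + r *\<^sub>R g"
    by transfer (auto simp: L2_rel_def scaleR_add_right intro!: sq sqR)
  show "(r + s) *\<^sub>R f = r *\<^sub>R f + s *\<^sub>R f"
    by transfer (auto simp: L2_rel_def scaleR_add_left intro!: sq sqR)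
  show "r *\<^sub>R s *\<^sub>R f = (r * s) *\<^sub>R f"
    by transfer (auto simp: L2_rel_def intro!: sq sqR)
  show "1 *\<^sub>R f = f"
    by transfer (auto simp: L2_rel_def)
qed

end

instantiation L2_half_line :: real_inner
begin

lift_definition inner_L2_half_line :: "L2_half_line \<Rightarrow> L2_half_line \<Rightarrow> real"
  is "\<lambda>f g. LINT t|half_line. inner (f t) (g t)"
  by (rule integral_cong_AE) (auto simp: L2_rel_def elim: eventually_elim2)

lift_definition norm_L2_half_line :: "L2_half_line \<Rightarrow> real"
  is "\<lambda>f. sqrt (LINT t|half_line. (cmod (f t))\<^sup>2)"
  by (intro arg_cong[of _ _ sqrt] integral_cong_AE) (auto simp: L2_rel_def)

definition "dist f g = norm (f - g)" for f g :: L2_half_line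

definition "sgn f = f /\<^sub>R norm f" for f :: L2_half_line

definition "uniformity = (INF e\<in>{0<..}. principal {(f :: L2_half_line, g). dist f g < e})"

definition "open U = (\<forall>f\<in>U. \<forall>\<^sub>F (f', g) in uniformity. f' = f \<longrightarrow> g \<in> U)"
  for U :: "L2_half_line set"

instance
proof
  fix f g h :: L2_half_line and r :: real
  show "dist f g = norm (f - g)" by (fact dist_L2_half_line_def)
  show "sgn f = f /\<^sub>R norm f" by (fact sgn_L2_half_line_def)
  show "uniformity = (INF e\<in>{0<..}. principal {(f :: L2_half_line, g). dist f g < e})"
    by (fact uniformity_L2_half_line_def)
  show "open U = (\<forall>f\<in>U. \<forall>\<^sub>F (f', g) in uniformity. f' = f \<longrightarrow> g \<in> U)" for U :: "L2_half_line set"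
    by (fact open_L2_half_line_def)
  show "inner f g = inner g f"
    by transfer (simp add: inner_commute)
  show "inner (f + g) h = inner f h + inner g h"
    by transfer (auto simp: L2_rel_def inner_add_left integrable_inner)
  show "inner (r *\<^sub>R f) g = r * inner f g"
    by transfer (auto simp: L2_rel_def)
  show "0 \<le> inner f f"
    by transfer (auto intro: integral_nonneg_AE)
  show "(inner f f = 0) = (f = 0)"
  proof transfer
    fix f assume "L2_rel f f"
    then have f: "square_integrable half_line f" by (simp add: L2_rel_def)
    have "(LINT t|half_line. inner (f t) (f t)) = 0 \<longleftrightarrow> (AE t in half_line. inner (f t) (f t) = 0)"
      using f by (intro integral_nonneg_eq_0_iff_AE integrable_inner) auto
    then show "(LINT t|half_line. inner (f t) (f t)) = 0 \<longleftrightarrow> L2_rel f (\<lambda>_. 0)"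
      using f by (simp add: L2_rel_def square_integrable_zero)
  qed
  show "norm f = sqrt (inner f f)"
    by transfer (simp add: power2_norm_eq_inner)
qed

end

lemma power2_norm_L2:
  assumes "square_integrable half_line f"
  shows "ennreal ((norm (abs_L2_half_line f))\<^sup>2) = (\<integral>\<^sup>+t. ennreal ((cmod (f t))\<^sup>2) \<partial>half_line)"
proof -
  have "norm (abs_L2_half_line f) = sqrt (LINT t|half_line. (cmod (f t))\<^sup>2)"
    using assms by (intro norm_L2_half_line.abs_eq) (simp add: L2_rel_def)
  moreover have "0 \<le> (LINT t|half_line. (cmod (f t))\<^sup>2)"
    by (intro integral_nonneg_AE) auto
  ultimately have "(norm (abs_L2_half_line f))\<^sup>2 = (LINT t|half_line. (cmod (f t))\<^sup>2)"
    by simp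
  then show ?thesis
    using assms by (subst nn_integral_eq_integral) (auto simp: square_integrable_def)
qed

text \<open>Riesz--Fischer: a rapidly convergent subsequence converges almost everywhere.\<close>

instance L2_half_line :: banach
proof
  fix X :: "nat \<Rightarrow> L2_half_line"
  assume X: "Cauchy X"
  define F where "F n = (SOME f. square_integrable half_line f \<and> abs_L2_half_line f = X n)" for n
  have "\<exists>f. square_integrable half_line f \<and> abs_L2_half_line f = X n" for n
    using L2_half_line.abs_induct[of "\<lambda>x. \<exists>f. square_integrable half_line f \<and> abs_L2_half_line f = x"]
    by (auto simp: L2_rel_def)
  then have F: "square_integrable half_line (F n)" "abs_L2_half_line (F n) = X n" for n
    unfolding F_def by (metis (mono_tags, lifting) someI_ex)+
  have [measurable]: "F n \<in> borel_measurable half_line" for n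
    using F(1) by (simp add: square_integrable_def)
  have diff: "ennreal ((dist (X m) (X n))\<^sup>2) =
      (\<integral>\<^sup>+t. ennreal ((cmod (F m t - F n t))\<^sup>2) \<partial>half_line)" for m n
  proof -
    have "X m - X n = abs_L2_half_line (\<lambda>t. F m t - F n t)"
      unfolding F(2)[symmetric]
      by (rule minus_L2_half_line.abs_eq) (use F(1) in \<open>auto simp: L2_rel_def\<close>)
    then show ?thesis
      by (simp add: dist_norm power2_norm_L2 F(1) square_integrable_diff)
  qed
  have "\<exists>N. \<forall>m\<ge>N. \<forall>n\<ge>N. dist (X m) (X n) < (1/2) ^ k" for k :: nat
    by (rule metric_CauchyD[OF X]) simp
  then obtain N where N: "\<And>k m n. m \<ge> N k \<Longrightarrow> n \<ge> N k \<Longrightarrow> dist (X m) (X n) < (1/2) ^ k"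
    by metis
  define r where "r = rec_nat (N 0) (\<lambda>k rk. max (N (Suc k)) rk)"
  have r: "r k \<ge> N k" "r (Suc k) \<ge> r k" for k
    by (cases k; simp add: r_def)+
  have rr: "dist (X (r (Suc k))) (X (r k)) < (1/2) ^ k" for k
    using r[of k] by (intro N) auto
  define G where "G k t = (cmod (F (r (Suc k)) t - F (r k) t))\<^sup>2" for k t
  have [measurable]: "G k \<in> borel_measurable half_line" for k
    unfolding G_def by measurable
  have "(\<integral>\<^sup>+t. (\<Sum>k. ennreal (2 ^ k * G k t)) \<partial>half_line) =
      (\<Sum>k. \<integral>\<^sup>+t. ennreal (2 ^ k * G k t) \<partial>half_line)"
    by (intro nn_integral_suminf) measurable
  also have "\<dots> \<le> (\<Sum>k. ennreal ((1/2) ^ k))"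
  proof (intro suminf_le)
    fix k
    have "(\<integral>\<^sup>+t. ennreal (2 ^ k * G k t) \<partial>half_line) =
        ennreal (2 ^ k) * (\<integral>\<^sup>+t. ennreal (G k t) \<partial>half_line)"
      by (subst nn_integral_cmult[symmetric]) (auto simp: ennreal_mult G_def)
    also have "\<dots> = ennreal (2 ^ k * (dist (X (r (Suc k))) (X (r k)))\<^sup>2)"
      unfolding G_def diff[symmetric] by (simp add: ennreal_mult)
    also have "\<dots> \<le> ennreal (2 ^ k * ((1/2) ^ k)\<^sup>2)"
      using rr[of k] by (intro ennreal_leI mult_left_mono power_mono) auto
    also have "(2::real) ^ k * ((1/2) ^ k)\<^sup>2 = (1/2) ^ k"
      by (simp add: power_mult_distrib power2_eq_square power_one_over)
    finally show "(\<integral>\<^sup>+t. ennreal (2 ^ k * G k t) \<partial>half_line) \<le> ennreal ((1/2) ^ k)" .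
  qed auto
  also have "\<dots> < \<infinity>"
    by (subst suminf_ennreal_eq[OF _ geometric_sums]) auto
  finally have "AE t in half_line. (\<Sum>k. ennreal (2 ^ k * G k t)) \<noteq> \<infinity>"
    by (intro nn_integral_PInf_AE) auto
  then have conv: "AE t in half_line. convergent (\<lambda>k. F (r k) t)"
  proof eventually_elim
    fix t assume fin: "(\<Sum>k. ennreal (2 ^ k * G k t)) \<noteq> \<infinity>"
    then have "summable (\<lambda>k. 2 ^ k * G k t)"
      by (intro summable_suminf_not_top) (auto simp: G_def)
    then have "Bseq (\<lambda>k. 2 ^ k * G k t)"
      by (intro convergent_imp_Bseq) (auto simp: convergent_def dest: summable_LIMSEQ_zero)
    then obtain K where K: "K > 0" "\<And>k. norm (2 ^ k * G k t) \<le> K"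
      by (auto simp: Bseq_def)
    define q :: real where "q = sqrt (1/2)"
    have q: "0 \<le> q" "q < 1" by (auto simp: q_def real_sqrt_lt_1_iff)
    have le: "cmod (F (r (Suc k)) t - F (r k) t) \<le> sqrt K * q ^ k" for k
    proof -
      have "G k t \<le> K * (1/2) ^ k"
        using K(2)[of k] by (simp add: abs_mult G_def field_simps)
      then have "sqrt (G k t) \<le> sqrt (K * (1/2) ^ k)"
        by (rule real_sqrt_le_mono)
      then show ?thesis
        by (simp add: G_def q_def real_sqrt_mult real_sqrt_power)
    qed
    have "summable (\<lambda>k. F (r (Suc k)) t - F (r k) t)"
      by (rule summable_comparison_test'[of "\<lambda>k. sqrt K * q ^ k" 0])
         (use q le in \<open>auto intro!: summable_mult summable_geometric\<close>)
    then have "(\<lambda>n. \<Sum>k<n. F (r (Suc k)) t - F (r k) t) \<longlonglongrightarrow>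
        (\<Sum>k. F (r (Suc k)) t - F (r k) t)"
      by (rule summable_LIMSEQ)
    then have "(\<lambda>n. F (r n) t - F (r 0) t) \<longlonglongrightarrow> (\<Sum>k. F (r (Suc k)) t - F (r k) t)"
      using sum_lessThan_telescope[of "\<lambda>k. F (r k) t"] by simp
    from tendsto_add[OF this tendsto_const[of "F (r 0) t"]]
    show "convergent (\<lambda>k. F (r k) t)"
      by (auto simp: convergent_def)
  qed
  define f where "f t = lim (\<lambda>k. F (r k) t)" for t
  have [measurable]: "f \<in> borel_measurable half_line"
    unfolding f_def by measurable
  have lim: "AE t in half_line. (\<lambda>k. F (r k) t) \<longlonglongrightarrow> f t"
    using conv by eventually_elim (simp add: f_def convergent_LIMSEQ_iff)
  have bound: "(\<integral>\<^sup>+t. ennreal ((cmod (F n t - f t))\<^sup>2) \<partial>half_line) \<le> ennreal (((1/2) ^ k)\<^sup>2)"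
    if n: "n \<ge> N k" for n k
  proof -
    have "(\<integral>\<^sup>+t. ennreal ((cmod (F n t - f t))\<^sup>2) \<partial>half_line) =
        (\<integral>\<^sup>+t. liminf (\<lambda>j. ennreal ((cmod (F n t - F (r j) t))\<^sup>2)) \<partial>half_line)"
    proof (rule nn_integral_cong_AE, use lim in eventually_elim)
      fix t assume "(\<lambda>j. F (r j) t) \<longlonglongrightarrow> f t"
      then have "(\<lambda>j. ennreal ((cmod (F n t - F (r j) t))\<^sup>2)) \<longlonglongrightarrow> ennreal ((cmod (F n t - f t))\<^sup>2)"
        by (intro tendsto_intros tendsto_ennrealI)
      then show "ennreal ((cmod (F n t - f t))\<^sup>2) =
          liminf (\<lambda>j. ennreal ((cmod (F n t - F (r j) t))\<^sup>2))"
        by (rule lim_imp_Liminf[OF sequentially_bot, symmetric])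
    qed
    also have "\<dots> \<le> liminf (\<lambda>j. \<integral>\<^sup>+t. ennreal ((cmod (F n t - F (r j) t))\<^sup>2) \<partial>half_line)"
      by (intro nn_integral_liminf) measurable
    also have "\<dots> = liminf (\<lambda>j. ennreal ((dist (X n) (X (r j)))\<^sup>2))"
      by (simp add: diff)
    also have "\<dots> \<le> liminf (\<lambda>j. ennreal (((1/2) ^ k)\<^sup>2))"
    proof (intro Liminf_mono, rule eventually_sequentiallyI)
      fix j assume "k \<le> j"
      then have "r k \<le> r j" using lift_Suc_mono_le[of r] r(2) by blast
      then have "r j \<ge> N k" using r(1)[of k] by linarith
      with n have "dist (X n) (X (r j)) < (1/2) ^ k" by (intro N)
      then show "ennreal ((dist (X n) (X (r j)))\<^sup>2) \<le> ennreal (((1/2) ^ k)\<^sup>2)"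
        by (intro ennreal_leI power_mono) auto
    qed
    also have "\<dots> = ennreal (((1/2) ^ k)\<^sup>2)"
      by (intro Liminf_const) simp
    finally show ?thesis .
  qed
  have Fmf: "square_integrable half_line (\<lambda>t. F n t - f t)" if "n \<ge> N k" for n k
    using le_less_trans[OF bound[OF that] ennreal_less_top]
    by (simp add: square_integrable_def integrable_iff_bounded)
  have f: "square_integrable half_line f"
    using square_integrable_diff[OF F(1)[of "N 0"] Fmf[OF order_refl[of "N 0"]]] by simp
  have "X \<longlonglongrightarrow> abs_L2_half_line f"
  proof (rule metric_LIMSEQ_I)
    fix e :: real assume "0 < e"
    then obtain k :: nat where k: "(1/2) ^ k < e"
      using real_arch_pow_inv[of e "1/2"] by auto
    have "dist (X n) (abs_L2_half_line f) < e" if n: "n \<ge> N k" for n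
    proof -
      have "X n - abs_L2_half_line f = abs_L2_half_line (\<lambda>t. F n t - f t)"
        unfolding F(2)[symmetric]
        by (rule minus_L2_half_line.abs_eq) (use F(1) f in \<open>auto simp: L2_rel_def\<close>)
      then have "ennreal ((dist (X n) (abs_L2_half_line f))\<^sup>2) \<le> ennreal (((1/2) ^ k)\<^sup>2)"
        using bound[OF n] by (simp add: dist_norm power2_norm_L2 Fmf[OF n])
      then have "dist (X n) (abs_L2_half_line f) \<le> (1/2) ^ k"
        by (subst (asm) ennreal_le_iff) (auto intro: power2_le_imp_le)
      with k show ?thesis by linarith
    qed
    then show "\<exists>n0. \<forall>n\<ge>n0. dist (X n) (abs_L2_half_line f) < e" by blast
  qed
  then show "convergent X" by (auto simp: convergent_def)
qed

instantiation L2_half_line :: complex_hilbert_space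
begin

lift_definition scaleC_L2_half_line :: "complex \<Rightarrow> L2_half_line \<Rightarrow> L2_half_line"
  is "\<lambda>c f t. c * f t"
  by (auto simp: L2_rel_def square_integrable_scale)

lift_definition cinner_L2_half_line :: "L2_half_line \<Rightarrow> L2_half_line \<Rightarrow> complex"
  is "\<lambda>f g. LINT t|half_line. f t * cnj (g t)"
  by (rule integral_cong_AE)
     (auto simp: L2_rel_def square_integrable_def elim: eventually_elim2
       intro!: borel_measurable_mult_cnj)

instance
proof
  fix f g h :: L2_half_line and a b :: complex and r :: real
  note sq = square_integrable_add square_integrable_scale
  show "a *\<^sub>C (f + g) = a *\<^sub>C f + a *\<^sub>C g"
    by transfer (auto simp: L2_rel_def distrib_left intro!: sq)
  show "(a + b) *\<^sub>C f = a *\<^sub>C f + b *\<^sub>C f"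
    by transfer (auto simp: L2_rel_def distrib_right intro!: sq)
  show "a *\<^sub>C b *\<^sub>C f = (a * b) *\<^sub>C f"
    by transfer (auto simp: L2_rel_def mult.assoc intro!: sq)
  show "complex_of_real r *\<^sub>C f = r *\<^sub>R f"
    by transfer (auto simp: L2_rel_def scaleR_conv_of_real intro!: sq)
  show "cinner f g = cnj (cinner g f)"
    by transfer (simp add: mult.commute flip: Bochner_Integration.integral_cnj)
  show "cinner (f + g) h = cinner f h + cinner g h"
    by transfer (auto simp: L2_rel_def distrib_right integrable_mult_cnj)
  show "cinner (a *\<^sub>C f) g = a * cinner f g"
    by transfer (simp add: mult.assoc)
  show "inner f g = Re (cinner f g)"
    by transfer
       (auto simp: L2_rel_def inner_complex_def integrable_mult_cnj simp flip: integral_Re)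
qed

end


section \<open>The backward shift\<close>

lemma lebesgue_translation_measurable [measurable]:
  "(\<lambda>t. t + c) \<in> lebesgue \<rightarrow>\<^sub>M (lebesgue :: real measure)"
  using lebesgue_affine_measurable[of "\<lambda>_. 1" c] by (simp add: add.commute)

lemma half_line_translation_measurable:
  "0 \<le> c \<Longrightarrow> (\<lambda>t. t + c) \<in> half_line \<rightarrow>\<^sub>M half_line"
  by (rule measurable_restrict_space3) auto

lemma AE_half_line_translation:
  assumes "0 \<le> c" "AE t in half_line. P t"
  shows "AE t in half_line. P (t + c)"
proof -
  have "AE t in lebesgue. t \<in> {0<..} \<longrightarrow> P t"
    using assms(2) by (simp add: AE_restrict_space_iff)
  also have "lebesgue = density (distr lebesgue lebesgue (\<lambda>t. t + c)) (\<lambda>_. 1)"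
    using lebesgue_real_affine[of 1 c] by (simp add: add.commute)
  finally have "AE t in distr lebesgue lebesgue (\<lambda>t. t + c). t \<in> {0<..} \<longrightarrow> P t"
    by (simp add: AE_density)
  then have "AE t in lebesgue. t + c \<in> {0<..} \<longrightarrow> P (t + c)"
    by (rule AE_distrD[OF lebesgue_translation_measurable])
  then have "AE t in lebesgue. t \<in> {0<..} \<longrightarrow> P (t + c)"
    by eventually_elim (use assms(1) in simp)
  then show ?thesis
    by (simp add: AE_restrict_space_iff)
qed

lemma square_integrable_translation:
  assumes c: "0 \<le> c" and f: "square_integrable half_line f"
  shows "square_integrable half_line (\<lambda>t. f (t + c))"
proof -
  have [measurable]: "f \<in> borel_measurable half_line"
    using f by (simp add: square_integrable_def)
  have m: "(\<lambda>t. f (t + c)) \<in> borel_measurable half_line"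
    by (rule measurable_compose[OF half_line_translation_measurable[OF c]]) fact
  let ?g = "\<lambda>t. ennreal ((cmod (f t))\<^sup>2) * indicator {0<..} t"
  have "(\<lambda>t. ennreal ((cmod (f t))\<^sup>2)) \<in> borel_measurable half_line"
    by measurable
  then have g: "?g \<in> borel_measurable lebesgue"
    by (subst (asm) borel_measurable_restrict_space_iff_ennreal) auto
  have "(\<integral>\<^sup>+t. ennreal ((cmod (f (t + c)))\<^sup>2) \<partial>half_line) \<le> (\<integral>\<^sup>+t. ?g (c + 1 * t) \<partial>lebesgue)"
  proof (subst nn_integral_restrict_space)
    show "(\<integral>\<^sup>+t. ennreal ((cmod (f (t + c)))\<^sup>2) * indicator {0<..} t \<partial>lebesgue) \<le>
        (\<integral>\<^sup>+t. ?g (c + 1 * t) \<partial>lebesgue)"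
    proof (intro nn_integral_mono)
      show "ennreal ((cmod (f (t + c)))\<^sup>2) * indicator {0<..} t \<le> ?g (c + 1 * t)" for t
        using c by (cases "0 < t") (simp_all add: add.commute[of c])
    qed
  qed simp
  also have "\<dots> = (\<integral>\<^sup>+t. ?g t \<partial>lebesgue)"
    using nn_integral_real_affine_lebesgue[OF g, of 1 c] by simp
  also have "\<dots> = (\<integral>\<^sup>+t. ennreal ((cmod (f t))\<^sup>2) \<partial>half_line)"
    by (subst nn_integral_restrict_space) auto
  also have "\<dots> < \<infinity>"
    using f by (simp add: square_integrable_def integrable_iff_bounded)
  finally show ?thesis
    using m by (simp add: square_integrable_def integrable_iff_bounded)
qed

lift_definition backward_shift :: "L2_half_line \<Rightarrow> L2_half_line" is "\<lambda>f t. f (t + 1)"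
proof -
  fix f g assume "L2_rel f g"
  then show "L2_rel (\<lambda>t. f (t + 1)) (\<lambda>t. g (t + 1))"
    using AE_half_line_translation[of 1 "\<lambda>t. f t = g t"]
    by (simp add: L2_rel_def square_integrable_translation)
qed

end

theory Submission
  imports Defs
begin

text \<open>
  The semigroup is first replaced by its cogenerator. Let \<open>A\<close> be the generator of \<open>T\<close>. It is
  dissipative and \<open>A - 1\<close> is onto, so the cogenerator \<open>W = (A + 1) (A - 1)\<^sup>-\<^sup>1\<close> is an everywhere
  defined contraction (lemma \<open>exists_cogenerator\<close>). Stability passes from \<open>T\<close> to \<open>W\<close>: the limit of the
  squared norms of \<open>W\<^sup>n x\<close> is a quadratic form invariant under \<open>W\<close>, hence under every \<open>T t\<close>, and it
  vanishes because \<open>T t x\<close> tends to \<open>0\<close> (lemma \<open>cogenerator_strongly_stable\<close>).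

  A contraction \<open>W\<close> whose powers tend strongly to \<open>0\<close> is unitarily equivalent to a restriction of a
  backward shift, by Rota's model: the squared norm of \<open>x\<close> is the sum of the squared norms that
  \<open>W\<^sup>n x\<close> loses under \<open>W\<close>, so recording all these losses embeds the space isometrically, and \<open>W\<close>
  drops the first record. On a separable space countably many scalar coordinates suffice for each
  record, and the backward shift on \<open>L\<^sup>2(0, \<infinity>)\<close> has room for them, since \<open>L\<^sup>2(0, 1)\<close> is infinite
  dimensional (lemma \<open>contraction_embeds_in_backward_shift\<close>).

  The resulting isometry \<open>J\<close> intertwines \<open>W\<close> with the cogenerator of \<open>U\<close>. It therefore maps the graph
  of the generator of \<open>T\<close> into that of \<open>U\<close>, and uniqueness of solutions of the evolution equation of a
  dissipative operator gives \<open>U t (J x) = J (T t x)\<close> (lemmas \<open>intertwines_generators\<close> and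
  \<open>intertwines_semigroups\<close>). The subspace is the range of \<open>J\<close>, closed because \<open>J\<close> is isometric, and
  \<open>R\<close> is the inverse of \<open>J\<close>.
\<close>


section \<open>Complex Hilbert spaces\<close>

lemma norm_scaleC: "norm (c *\<^sub>C x) = cmod c * norm x"
  for x :: "'a::complex_hilbert_space"
proof -
  have "cinner (c *\<^sub>C x) (c *\<^sub>C x) = c * cnj c * cinner x x"
    using cinner_commute[of x "c *\<^sub>C x"] cinner_commute[of x x, symmetric]
    by (simp add: cinner_scaleC_left)
  then have "complex_of_real ((norm (c *\<^sub>C x))\<^sup>2) =
      complex_of_real ((cmod c)\<^sup>2) * complex_of_real ((norm x)\<^sup>2)"
    by (simp only: cinner_self complex_norm_square)
  then have "(norm (c *\<^sub>C x))\<^sup>2 = (cmod c * norm x)\<^sup>2"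
    by (simp only: of_real_eq_iff power_mult_distrib flip: of_real_mult)
  then show ?thesis
    by simp
qed

lemma bounded_linear_scaleC: "bounded_linear (\<lambda>x. c *\<^sub>C (x :: 'a::complex_hilbert_space))"
proof (rule bounded_linear_intro)
  show "c *\<^sub>C (r *\<^sub>R x) = r *\<^sub>R (c *\<^sub>C x)" for r and x :: 'a
    by (simp add: scaleC_scaleC mult.commute flip: scaleC_of_real)
  show "norm (c *\<^sub>C x) \<le> norm x * cmod c" for x :: 'a
    by (simp add: norm_scaleC)
qed (rule scaleC_add_right)

lemma bounded_clinear_imp_bounded_linear:
  assumes "bounded_clinear F"
  shows "bounded_linear F"
proof -
  obtain K where "\<And>x. norm (F x) \<le> K * norm x"
    using assms by (auto simp: bounded_clinear_on_def)
  then show ?thesis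
    using assms by (intro bounded_linear_intro[of F K])
      (auto simp: bounded_clinear_on_def mult.commute simp flip: scaleC_of_real)
qed

lemma bounded_clinear_scaleC: "bounded_clinear F \<Longrightarrow> F (c *\<^sub>C x) = c *\<^sub>C F x"
  by (simp add: bounded_clinear_on_def)

lemma bounded_clinear_contractionI:
  assumes "\<And>x y. F (x + y) = F x + F y" "\<And>c x. F (c *\<^sub>C x) = c *\<^sub>C F x"
    and "\<And>x. norm (F x) \<le> norm x"
  shows "bounded_clinear F"
  using assms by (auto simp: bounded_clinear_on_def intro!: exI[of _ 1])


section \<open>Right derivatives\<close>

lemma has_vector_derivative_at_right_iff:
  "(f has_vector_derivative D) (at_right t) \<longleftrightarrow>
     ((\<lambda>h. (f (t + h) - f t) /\<^sub>R h) \<longlongrightarrow> D) (at_right 0)"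
proof -
  have "(f has_vector_derivative D) (at_right t) \<longleftrightarrow>
      ((\<lambda>s. (f s - f t) /\<^sub>R (s - t)) \<longlongrightarrow> D) (at_right t)"
  proof -
    have "\<forall>\<^sub>F s in at_right t. norm (f s - f t - (s - t) *\<^sub>R D) / norm (s - t) =
        norm ((f s - f t) /\<^sub>R (s - t) - D)"
      unfolding eventually_at_filter
    proof (intro always_eventually allI impI)
      fix s assume "s \<in> {t<..}"
      then have "(f s - f t) /\<^sub>R (s - t) - D = (f s - f t - (s - t) *\<^sub>R D) /\<^sub>R (s - t)"
        by (simp add: scaleR_diff_right)
      then show "norm (f s - f t - (s - t) *\<^sub>R D) / norm (s - t) =
          norm ((f s - f t) /\<^sub>R (s - t) - D)"
        by (simp add: divide_inverse mult.commute)
    qed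
    then have "(f has_vector_derivative D) (at_right t) \<longleftrightarrow>
        ((\<lambda>s. norm ((f s - f t) /\<^sub>R (s - t) - D)) \<longlongrightarrow> 0) (at_right t)"
      by (simp add: has_vector_derivative_def has_derivative_iff_norm bounded_linear_scaleR_left
          tendsto_cong)
    also have "\<dots> \<longleftrightarrow> ((\<lambda>s. (f s - f t) /\<^sub>R (s - t)) \<longlongrightarrow> D) (at_right t)"
      unfolding tendsto_norm_zero_iff by (rule LIM_zero_iff)
    finally show ?thesis .
  qed
  also have "\<dots> \<longleftrightarrow> ((\<lambda>h. (f (t + h) - f t) /\<^sub>R h) \<longlongrightarrow> D) (at_right 0)"
    by (simp add: at_right_to_0[of t] filterlim_filtermap add.commute)
  finally show ?thesis .
qed

lemma has_right_derivative_cong: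
  assumes "(f has_vector_derivative D) (at_right t)" "\<And>s. s \<ge> t \<Longrightarrow> f s = g s"
  shows "(g has_vector_derivative D) (at_right t)"
proof -
  have "\<forall>\<^sub>F h in at_right 0. (f (t + h) - f t) /\<^sub>R h = (g (t + h) - g t) /\<^sub>R h"
    using assms(2) by (simp add: eventually_at_filter)
  from tendsto_cong[OF this] assms(1) show ?thesis
    by (simp add: has_vector_derivative_at_right_iff)
qed

text \<open>
  Subtracting a small multiple of \<open>t\<close> makes the right derivative strictly negative. The last point
  of \<open>[0, b]\<close> at which the function is at most its initial value must then be \<open>b\<close>, because the
  function still decreases just to the right of any such point. Right derivatives are what the
  semigroup law yields directly from the definition of the generator.
\<close>

lemma nonincreasing_if_right_derivative_le_0:
  fixes f :: "real \<Rightarrow> real"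
  assumes cont: "continuous_on {0..} f"
    and deriv: "\<And>t. t \<ge> 0 \<Longrightarrow> \<exists>D\<le>0. (f has_vector_derivative D) (at_right t)"
    and "b \<ge> 0"
  shows "f b \<le> f 0"
proof (rule field_le_epsilon)
  fix e :: real assume "e > 0"
  define g where "g t = f t - e / (b + 1) * t" for t
  have e: "e / (b + 1) > 0"
    using \<open>b \<ge> 0\<close> \<open>e > 0\<close> by simp
  have g_cont: "continuous_on {0..} g"
    unfolding g_def by (intro continuous_intros cont)
  define S where "S = {t \<in> {0..b}. g t \<le> g 0}"
  have "compact S"
  proof -
    have "continuous_on {0..b} g"
      using g_cont by (rule continuous_on_subset) auto
    then have "closed S"
      unfolding S_def by (intro continuous_on_closed_Collect_le continuous_intros) auto
    moreover have "bounded S"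
      by (rule bounded_subset[of "{0..b}"]) (auto simp: S_def)
    ultimately show ?thesis
      by (simp add: compact_eq_bounded_closed)
  qed
  moreover have "0 \<in> S"
    using \<open>b \<ge> 0\<close> by (simp add: S_def)
  ultimately obtain s where s: "s \<in> S" "\<And>t. t \<in> S \<Longrightarrow> t \<le> s"
    using compact_attains_sup[of S] by blast
  have "s = b"
  proof (rule ccontr)
    assume "s \<noteq> b"
    with s have "0 \<le> s" "s < b" "g s \<le> g 0"
      by (auto simp: S_def)
    from deriv[OF \<open>0 \<le> s\<close>] obtain D where D: "D \<le> 0" "(f has_real_derivative D) (at_right s)"
      by (auto simp: has_real_derivative_iff_has_vector_derivative)
    have "(g has_real_derivative D - e / (b + 1)) (at_right s)"
      unfolding g_def by (intro DERIV_diff D(2) DERIV_cmult_Id)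
    moreover have "D - e / (b + 1) < 0"
      using D(1) e by simp
    ultimately have "\<exists>d>0. \<forall>h>0. s + h \<in> {s<..} \<longrightarrow> h < d \<longrightarrow> g s > g (s + h)"
      by (rule has_real_derivative_neg_dec_right)
    then obtain d where d: "d > 0" "\<And>h. h > 0 \<Longrightarrow> h < d \<Longrightarrow> g (s + h) < g s"
      by auto
    define h where "h = min (d / 2) (b - s)"
    have "h > 0" "h < d" "s + h \<le> b"
      using d(1) \<open>s < b\<close> by (auto simp: h_def min_def)
    with d(2)[of h] \<open>g s \<le> g 0\<close> \<open>0 \<le> s\<close> have "s + h \<in> S"
      by (auto simp: S_def)
    from s(2)[OF this] \<open>h > 0\<close> show False by simp
  qed
  with s have "g b \<le> g 0"
    by (simp add: S_def)
  moreover have "e / (b + 1) * b \<le> e"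
    using mult_left_mono[of "b / (b + 1)" 1 e] \<open>b \<ge> 0\<close> \<open>e > 0\<close> by simp
  ultimately show "f b \<le> f 0 + e"
    by (simp add: g_def)
qed

lemma constant_if_right_derivative_0:
  fixes f :: "real \<Rightarrow> real"
  assumes "continuous_on {0..} f" "\<And>t. t \<ge> 0 \<Longrightarrow> (f has_vector_derivative 0) (at_right t)" "b \<ge> 0"
  shows "f b = f 0"
proof (rule antisym)
  show "f b \<le> f 0"
    using assms(1) _ assms(3) by (rule nonincreasing_if_right_derivative_le_0) (use assms(2) in auto)
  have "\<exists>D\<le>0. ((\<lambda>t. - f t) has_vector_derivative D) (at_right t)" if "t \<ge> 0" for t
    using has_vector_derivative_minus[OF assms(2)[OF that]] by auto
  then have "- f b \<le> - f 0"
    by (intro nonincreasing_if_right_derivative_le_0[OF continuous_on_minus[OF assms(1)] _ assms(3)])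
  then show "f 0 \<le> f b" by simp
qed


section \<open>Semigroups and their generators\<close>

lemma C0_semigroupD:
  assumes "C0_semigroup T"
  shows "t \<ge> 0 \<Longrightarrow> bounded_clinear (T t)" "T 0 x = x"
    "s \<ge> 0 \<Longrightarrow> t \<ge> 0 \<Longrightarrow> T (s + t) x = T s (T t x)" "continuous_on {0..} (\<lambda>t. T t x)"
  using assms by (auto simp: C0_semigroup_def)

lemma C0_semigroup_bounded_linear:
  "C0_semigroup T \<Longrightarrow> t \<ge> 0 \<Longrightarrow> bounded_linear (T t)"
  by (intro bounded_clinear_imp_bounded_linear C0_semigroupD)

text \<open>
  The graph of the generator. As a relation it carries membership in the domain along with the
  value, so that linear combinations and orbits of domain elements are handled in one statement.
\<close>

definition generates ::
  "(real \<Rightarrow> 'a \<Rightarrow> 'a::complex_hilbert_space) \<Rightarrow> 'a \<Rightarrow> 'a \<Rightarrow> bool" where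
  "generates T x y \<longleftrightarrow> ((\<lambda>h. (T h x - x) /\<^sub>R h) \<longlongrightarrow> y) (at_right 0)"

lemma generates_iff: "generates T x y \<longleftrightarrow> x \<in> generator_domain T \<and> generator T x = y"
  unfolding generates_def generator_domain_def generator_def
  by (auto simp: tendsto_Lim)

context
  fixes T :: "real \<Rightarrow> 'a \<Rightarrow> 'a::complex_hilbert_space"
  assumes T: "C0_semigroup T"
begin

lemma generates_iff_has_vector_derivative:
  "generates T x y \<longleftrightarrow> ((\<lambda>h. T h x) has_vector_derivative y) (at_right 0)"
  by (simp add: generates_def has_vector_derivative_at_right_iff C0_semigroupD(2)[OF T])

lemma generates_add:
  assumes "generates T x y" "generates T x' y'"
  shows "generates T (x + x') (y + y')"
proof -
  have "((\<lambda>h. T h x + T h x') has_vector_derivative y + y') (at_right 0)"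
    using assms unfolding generates_iff_has_vector_derivative by (rule has_vector_derivative_add)
  then show ?thesis
    unfolding generates_iff_has_vector_derivative
    by (rule has_right_derivative_cong)
       (simp add: linear_add bounded_linear.linear C0_semigroup_bounded_linear[OF T])
qed

lemma generates_scaleC:
  assumes "generates T x y"
  shows "generates T (c *\<^sub>C x) (c *\<^sub>C y)"
proof -
  have "((\<lambda>h. c *\<^sub>C T h x) has_vector_derivative c *\<^sub>C y) (at_right 0)"
    using assms unfolding generates_iff_has_vector_derivative
    by (rule bounded_linear.has_vector_derivative[OF bounded_linear_scaleC])
  then show ?thesis
    unfolding generates_iff_has_vector_derivative
    by (rule has_right_derivative_cong) (simp add: bounded_clinear_scaleC C0_semigroupD(1)[OF T])
qed

lemma generates_scaleR: "generates T x y \<Longrightarrow> generates T (r *\<^sub>R x) (r *\<^sub>R y)"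
  using generates_scaleC[of x y "complex_of_real r"] by (simp add: scaleC_of_real)

lemma generates_diff:
  assumes "generates T x y" "generates T x' y'"
  shows "generates T (x - x') (y - y')"
  using generates_add[OF assms(1) generates_scaleR[OF assms(2), of "-1"]] by simp

lemma generates_orbit:
  assumes "generates T x y" "t \<ge> 0"
  shows "generates T (T t x) (T t y)"
proof -
  have "((\<lambda>h. T t (T h x)) has_vector_derivative T t y) (at_right 0)"
    using assms(1) unfolding generates_iff_has_vector_derivative
    by (rule bounded_linear.has_vector_derivative[OF C0_semigroup_bounded_linear[OF T assms(2)]])
  then show ?thesis
    unfolding generates_iff_has_vector_derivative
    by (rule has_right_derivative_cong)
       (use assms(2) in \<open>simp add: add.commute flip: C0_semigroupD(3)[OF T]\<close>)
qed

lemma orbit_has_right_derivative: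
  assumes "generates T x y" "t \<ge> 0"
  shows "((\<lambda>s. T s x) has_vector_derivative T t y) (at_right t)"
proof -
  have "((\<lambda>h. T h (T t x)) has_vector_derivative T t y) (at_right 0)"
    using generates_orbit[OF assms] by (simp only: generates_iff_has_vector_derivative)
  then have "((\<lambda>h. T (t + h) x) has_vector_derivative T t y) (at_right 0)"
    by (rule has_right_derivative_cong)
       (use assms(2) in \<open>simp add: add.commute[of t] flip: C0_semigroupD(3)[OF T]\<close>)
  then show ?thesis
    by (simp add: has_vector_derivative_at_right_iff)
qed

text \<open>
  The generator \<open>A\<close> is densely defined as soon as \<open>A - 1\<close> is onto: if \<open>x = A z - z\<close>, then \<open>x\<close> is the
  limit of \<open>(T h z - z) / h - z\<close>, and these vectors lie in the domain because orbits of domain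
  elements stay in it. The conclusion is phrased for the form in which density is used, to extend
  a closed condition from the domain to the whole space.
\<close>

lemma in_closed_superset_of_generator_domain:
  assumes surj: "\<And>x. \<exists>z. generates T z (z + x)"
    and closed: "closed S" and S: "\<And>x y. generates T x y \<Longrightarrow> x \<in> S"
  shows "x \<in> S"
proof -
  obtain z where z: "generates T z (z + x)"
    using surj by blast
  have "((\<lambda>h. (T h z - z) /\<^sub>R h - z) \<longlongrightarrow> (z + x) - z) (at_right 0)"
    using z by (intro tendsto_diff tendsto_const) (simp add: generates_def)
  then have lim: "((\<lambda>h. (T h z - z) /\<^sub>R h - z) \<longlongrightarrow> x) (at_right 0)"
    by simp
  have "(T h z - z) /\<^sub>R h - z \<in> S" if "h > 0" for h
    using that by (intro S[OF generates_diff[OF generates_scaleR[OF generates_diff[OF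
      generates_orbit[OF z] z]] z]]) simp
  then have "\<forall>\<^sub>F h in at_right 0. (T h z - z) /\<^sub>R h - z \<in> S"
    by (simp add: eventually_at_filter)
  then show ?thesis
    by (rule Lim_in_closed_set[OF closed _ _ lim]) simp
qed

end

lemma contraction_semigroup_dissipative:
  assumes T: "C0_semigroup T" and contr: "\<And>t x. t \<ge> 0 \<Longrightarrow> norm (T t x) \<le> norm x"
    and xy: "generates T x y"
  shows "inner y x \<le> 0"
proof (rule tendsto_upperbound)
  show "((\<lambda>h. inner ((T h x - x) /\<^sub>R h) x) \<longlongrightarrow> inner y x) (at_right 0)"
    using xy by (intro tendsto_intros) (simp add: generates_def)
  have "inner ((T h x - x) /\<^sub>R h) x \<le> 0" if "h > 0" for h
  proof -
    have "inner (T h x) x \<le> norm (T h x) * norm x"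
      by (rule norm_cauchy_schwarz)
    also have "\<dots> \<le> inner x x"
      using contr[of h x] that
      by (simp add: mult_right_mono power2_eq_square flip: power2_norm_eq_inner)
    finally have "inner (T h x - x) x \<le> 0"
      by (simp add: inner_diff_left)
    then show ?thesis
      using that by (simp add: mult_le_0_iff)
  qed
  then show "\<forall>\<^sub>F h in at_right 0. inner ((T h x - x) /\<^sub>R h) x \<le> 0"
    by (simp add: eventually_at_filter)
qed simp

text \<open>
  The preimage of \<open>x\<close> is \<open>- z\<close>, where \<open>z\<close> is the Laplace transform of the orbit of \<open>x\<close> at \<open>1\<close>, the
  integral of \<open>f t = exp (- t) *\<^sub>R T t x\<close> over the half-line. Shifting the integral gives
  \<open>T h z = exp h *\<^sub>R (z - F h)\<close>, where \<open>F h\<close> is the integral of \<open>f\<close> over \<open>[0, h]\<close>, and the right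
  derivative of this at \<open>0\<close> is \<open>z - x\<close>.
\<close>

lemma generator_minus_id_surj:
  fixes T :: "real \<Rightarrow> 'a \<Rightarrow> 'a::complex_hilbert_space"
  assumes T: "C0_semigroup T" and contr: "\<And>t x. t \<ge> 0 \<Longrightarrow> norm (T t x) \<le> norm x"
  shows "\<exists>z. generates T z (z + x)"
proof -
  define f where "f t = exp (- t) *\<^sub>R T t x" for t
  define F where "F t = integral {0..t} f" for t
  have cont: "continuous_on {a..b} f" if "a \<ge> 0" for a b
    unfolding f_def
    by (intro continuous_intros continuous_on_subset[OF C0_semigroupD(4)[OF T]]) (use that in auto)
  have int: "f integrable_on {a..b}" if "a \<ge> 0" for a b
    using cont[OF that] by (rule integrable_continuous_real)
  have tail: "norm (integral {a..b} f) \<le> exp (- a) * norm x * (b - a)" if "0 \<le> a" "a \<le> b" for a b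
  proof (rule integral_bound)
    show "norm (f t) \<le> exp (- a) * norm x" if "t \<in> {a..b}" for t
      using that \<open>0 \<le> a\<close> by (auto simp: f_def intro!: mult_mono contr)
  qed (use that cont in auto)
  have F_diff: "F b - F a = integral {a..b} f" if "0 \<le> a" "a \<le> b" for a b
    using Henstock_Kurzweil_Integration.integral_combine[of 0 a b f] that int
    by (simp add: F_def algebra_simps)

  (* The improper integral is summed over unit intervals, which decay geometrically. *)
  have "summable (\<lambda>n. F (real (Suc n)) - F (real n))"
  proof (rule summable_comparison_test')
    show "summable (\<lambda>n. exp (- 1) ^ n * norm x)"
      by (intro summable_mult2 summable_geometric) simp
    show "norm (F (real (Suc n)) - F (real n)) \<le> exp (- 1) ^ n * norm x" for n
      using tail[of "real n" "real (Suc n)"] F_diff[of "real n" "real (Suc n)"]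
      by (simp flip: exp_of_nat_mult)
  qed
  then obtain z where "(\<lambda>n. \<Sum>k<n. F (real (Suc k)) - F (real k)) \<longlonglongrightarrow> z"
    by (auto dest: summable_LIMSEQ)
  moreover have "F 0 = 0"
    by (simp add: F_def)
  ultimately have z: "(\<lambda>n. F (real n)) \<longlonglongrightarrow> z"
    using sum_lessThan_telescope[of "\<lambda>k. F (real k)"] by simp

  have "T h z = exp h *\<^sub>R (z - F h)" if h: "h \<ge> 0" for h
  proof -
    have eq: "T h (F (real n)) = exp h *\<^sub>R (F (real n) + (F (real n + h) - F (real n)) - F h)" for n
    proof -
      interpret Th: bounded_linear "T h"
        using T h by (rule C0_semigroup_bounded_linear)
      have "T h (F (real n)) = integral {0..real n} (T h \<circ> f)"
        unfolding F_def
        by (rule integral_linear[symmetric]) (use int Th.bounded_linear_axioms in auto)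
      also have "\<dots> = integral {0..real n} (\<lambda>t. exp h *\<^sub>R f (t + h))"
      proof (rule integral_cong)
        fix t assume "t \<in> {0..real n}"
        then show "(T h \<circ> f) t = exp h *\<^sub>R f (t + h)"
          using h by (simp add: f_def Th.scaleR add.commute[of t] C0_semigroupD(3)[OF T] flip: exp_add)
      qed
      also have "\<dots> = exp h *\<^sub>R integral {h..real n + h} f"
        using has_integral_shift_real_ivl[OF integrable_integral, OF int[OF h, of "real n + h"],
            where c = h]
        by (simp add: integral_unique)
      finally show ?thesis
        using F_diff[of h "real n + h"] h by simp
    qed
    have "(\<lambda>n. F (real n + h) - F (real n)) \<longlonglongrightarrow> 0"
    proof (rule Lim_null_comparison)
      have "norm (F (real n + h) - F (real n)) \<le> exp (- 1) ^ n * (norm x * h)" for n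
        using h tail[of "real n" "real n + h"]
        by (simp add: F_diff mult.assoc flip: exp_of_nat_mult)
      then show "\<forall>\<^sub>F n in sequentially.
          norm (F (real n + h) - F (real n)) \<le> exp (- 1) ^ n * (norm x * h)"
        by simp
      show "(\<lambda>n. exp (- 1 :: real) ^ n * (norm x * h)) \<longlonglongrightarrow> 0"
        by (intro tendsto_mult_left_zero LIMSEQ_realpow_zero) auto
    qed
    then have "(\<lambda>n. T h (F (real n))) \<longlonglongrightarrow> exp h *\<^sub>R (z + 0 - F h)"
      unfolding eq by (intro tendsto_intros z)
    moreover have "(\<lambda>n. T h (F (real n))) \<longlonglongrightarrow> T h z"
      using z by (rule bounded_linear.tendsto[OF C0_semigroup_bounded_linear[OF T h]])
    ultimately show ?thesis
      by (simp add: LIMSEQ_unique)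
  qed
  moreover have "((\<lambda>h. exp h *\<^sub>R (z - F h)) has_vector_derivative z - x) (at_right 0)"
  proof -
    have "(F has_vector_derivative f 0) (at 0 within {0..1})"
      unfolding F_def by (rule integral_has_vector_derivative) (use cont in auto)
    then have "(F has_vector_derivative f 0) (at_right 0)"
      by (simp add: at_within_Icc_at_right)
    then have "((\<lambda>h. exp h *\<^sub>R (z - F h)) has_vector_derivative
        exp 0 *\<^sub>R (0 - f 0) + exp 0 *\<^sub>R (z - F 0)) (at_right 0)"
      by (intro has_vector_derivative_scaleR has_vector_derivative_diff has_vector_derivative_const
          DERIV_subset[OF DERIV_exp]) auto
    then show ?thesis
      by (simp add: f_def F_def C0_semigroupD(2)[OF T])
  qed
  ultimately have "generates T z (z - x)"
    unfolding generates_iff_has_vector_derivative[OF T]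
    by (metis (no_types, lifting) has_right_derivative_cong)
  then have "generates T (- z) (- z + x)"
    using generates_scaleR[OF T, of z "z - x" "-1"] by simp
  then show ?thesis ..
qed


section \<open>The cogenerator of a contraction semigroup\<close>

text \<open>
  With \<open>G = (A - 1)\<^sup>-\<^sup>1\<close> the cogenerator \<open>(A + 1) (A - 1)\<^sup>-\<^sup>1\<close> is \<open>1 + 2 G\<close>, defined everywhere because
  \<open>A - 1\<close> is onto, and single-valued because \<open>A\<close> is dissipative. Contractivity is dissipativity
  again: the squared norms of \<open>A z + z\<close> and \<open>A z - z\<close> differ by \<open>4 * inner (A z) z\<close>.
\<close>

lemma exists_cogenerator:
  fixes T :: "real \<Rightarrow> 'a \<Rightarrow> 'a::complex_hilbert_space"
  assumes T: "C0_semigroup T" and contr: "\<And>t x. t \<ge> 0 \<Longrightarrow> norm (T t x) \<le> norm x"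
  obtains W where "bounded_clinear W" "\<And>x. norm (W x) \<le> norm x"
    "\<And>x y. generates T x y \<Longrightarrow> W (y - x) = y + x"
proof -
  obtain G where G: "\<And>x. generates T (G x) (G x + x)"
    using generator_minus_id_surj[OF assms] by metis
  have unique: "z = 0" if "generates T z z" for z
    using contraction_semigroup_dissipative[OF T contr that] inner_ge_zero[of z]
    by (metis antisym inner_eq_zero_iff)
  have G_eqI: "G (y - x) = x" if "generates T x y" for x y
    using unique[of "G (y - x) - x"] generates_diff[OF T G[of "y - x"] that] by simp
  have G_add: "G (x + y) = G x + G y" for x y
    using G_eqI[OF generates_add[OF T G[of x] G[of y]]] by (simp add: algebra_simps)
  have G_scale: "G (c *\<^sub>C x) = c *\<^sub>C G x" for c x
    using G_eqI[OF generates_scaleC[OF T G[of x], of c]] by (simp add: scaleC_add_right)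
  define W where "W x = x + 2 *\<^sub>R G x" for x
  show thesis
  proof
    show norm_W: "norm (W x) \<le> norm x" for x
    proof -
      have "inner (G x + x) (G x) \<le> 0"
        using contraction_semigroup_dissipative[OF T contr G] .
      then have "(norm (W x))\<^sup>2 \<le> (norm x)\<^sup>2"
        by (simp add: W_def power2_norm_eq_inner inner_add_left inner_add_right inner_commute)
      then show ?thesis
        by (rule power2_le_imp_le) simp
    qed
    show "bounded_clinear W"
    proof (rule bounded_clinear_contractionI)
      show "W (x + y) = W x + W y" for x y
        by (simp add: W_def G_add scaleR_add_right)
      show "W (c *\<^sub>C x) = c *\<^sub>C W x" for c x
        by (simp add: W_def G_scale scaleC_add_right scaleC_scaleC mult.commute flip: scaleC_of_real)
    qed (rule norm_W)
    show "W (y - x) = y + x" if "generates T x y" for x y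
      by (simp add: W_def G_eqI[OF that] scaleR_2)
  qed
qed

lemma norm_funpow_contraction_le:
  fixes W :: "'a \<Rightarrow> 'a::real_normed_vector"
  assumes "\<And>x. norm (W x) \<le> norm x"
  shows "norm ((W ^^ n) x) \<le> norm x"
proof (induction n)
  case (Suc n)
  then show ?case
    using assms[of "(W ^^ n) x"] by simp
qed simp

text \<open>
  The squared norms along an orbit of a contraction decrease, hence converge, and polarization
  carries the convergence over to inner products. The limit form measures the part of each vector
  that the iteration never loses.
\<close>

lemma asymptotic_form:
  fixes W :: "'a \<Rightarrow> 'a::real_inner"
  assumes lin: "linear W" and contr: "\<And>x. norm (W x) \<le> norm x"
  obtains b :: "'a \<Rightarrow> 'a \<Rightarrow> real" where "bounded_bilinear b"
    "\<And>x y. (\<lambda>n. inner ((W ^^ n) x) ((W ^^ n) y)) \<longlonglongrightarrow> b x y"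
proof -
  have lin_n: "linear (W ^^ n)" for n
  proof (induction n)
    case (Suc n)
    show ?case
      unfolding funpow.simps by (rule linear_compose[OF Suc lin])
  qed (unfold funpow.simps, rule linear_id)
  have conv: "convergent (\<lambda>n. (norm ((W ^^ n) x))\<^sup>2)" for x
  proof (rule Bseq_monoseq_convergent)
    have "decseq (\<lambda>n. (norm ((W ^^ n) x))\<^sup>2)"
      by (rule decseq_SucI) (simp add: contr power_mono)
    then show "monoseq (\<lambda>n. (norm ((W ^^ n) x))\<^sup>2)"
      by (rule decseq_imp_monoseq)
    show "Bseq (\<lambda>n. (norm ((W ^^ n) x))\<^sup>2)"
      by (rule BseqI'[of _ "(norm x)\<^sup>2"])
         (simp add: norm_funpow_contraction_le[OF contr] power_mono)
  qed
  have "convergent (\<lambda>n. inner ((W ^^ n) x) ((W ^^ n) y))" for x y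
  proof -
    have eq: "inner ((W ^^ n) x) ((W ^^ n) y) =
        ((norm ((W ^^ n) (x + y)))\<^sup>2 - (norm ((W ^^ n) x))\<^sup>2 - (norm ((W ^^ n) y))\<^sup>2) * (1 / 2)" for n
      by (simp add: linear_add[OF lin_n] dot_norm)
    have "convergent (\<lambda>n. ((norm ((W ^^ n) (x + y)))\<^sup>2 - (norm ((W ^^ n) x))\<^sup>2 -
        (norm ((W ^^ n) y))\<^sup>2) * (1 / 2))"
      by (intro convergent_mult convergent_diff convergent_const conv)
    then show ?thesis by (simp only: eq)
  qed
  then obtain b where b: "\<And>x y. (\<lambda>n. inner ((W ^^ n) x) ((W ^^ n) y)) \<longlonglongrightarrow> b x y"
    unfolding convergent_def by metis
  have eqI: "b x y = s" if "(\<lambda>n. inner ((W ^^ n) x) ((W ^^ n) y)) \<longlonglongrightarrow> s" for x y s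
    using b that by (rule LIMSEQ_unique)
  have "bounded_bilinear b"
  proof
    fix x x' y y' and r :: real
    show "b (x + x') y = b x y + b x' y"
      by (rule eqI) (simp add: linear_add[OF lin_n] inner_add_left tendsto_add b)
    show "b x (y + y') = b x y + b x y'"
      by (rule eqI) (simp add: linear_add[OF lin_n] inner_add_right tendsto_add b)
    show "b (r *\<^sub>R x) y = r *\<^sub>R b x y"
      by (rule eqI) (simp add: linear_scale[OF lin_n] tendsto_mult_left b)
    show "b x (r *\<^sub>R y) = r *\<^sub>R b x y"
      by (rule eqI) (simp add: linear_scale[OF lin_n] tendsto_mult_left b)
    show "\<exists>K. \<forall>x y. norm (b x y) \<le> norm x * norm y * K"
    proof (intro exI[of _ 1] allI)
      fix x y
      have "\<bar>inner ((W ^^ n) x) ((W ^^ n) y)\<bar> \<le> norm x * norm y" for n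
        using Cauchy_Schwarz_ineq2[of "(W ^^ n) x" "(W ^^ n) y"]
          mult_mono[OF norm_funpow_contraction_le[OF contr, of n x]
            norm_funpow_contraction_le[OF contr, of n y]] by simp
      then have "\<bar>b x y\<bar> \<le> norm x * norm y"
        by (intro LIMSEQ_le_const2[OF tendsto_rabs[OF b]]) auto
      then show "norm (b x y) \<le> norm x * norm y * 1"
        by simp
    qed
  qed
  from this b show thesis by (rule that)
qed

text \<open>
  Let \<open>b\<close> be the asymptotic form of \<open>W\<close>. It is invariant under \<open>W\<close>, so \<open>A x + x\<close> and \<open>A x - x\<close> have
  the same \<open>b\<close>-square, which means \<open>b x (A x) = 0\<close>. Hence \<open>b\<close> is constant along the orbits of the
  semigroup, while it is bounded by the squared norm, which tends to \<open>0\<close> along them. So \<open>b\<close>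
  vanishes on the domain of \<open>A\<close> and, by density, everywhere.
\<close>

lemma cogenerator_strongly_stable:
  fixes T :: "real \<Rightarrow> 'a \<Rightarrow> 'a::complex_hilbert_space"
  assumes T: "C0_dot_contraction_semigroup T"
    and W: "linear W" "\<And>x. norm (W x) \<le> norm x"
    and cogen: "\<And>x y. generates T x y \<Longrightarrow> W (y - x) = y + x"
  shows "(\<lambda>n. (W ^^ n) x) \<longlonglongrightarrow> 0"
proof -
  have C0: "C0_semigroup T" and contr: "\<And>t x. t \<ge> 0 \<Longrightarrow> norm (T t x) \<le> norm x"
    and stable: "\<And>x. ((\<lambda>t. norm (T t x)) \<longlongrightarrow> 0) at_top"
    using T by (auto simp: C0_dot_contraction_semigroup_def)
  obtain b where "bounded_bilinear b"
    and b: "\<And>x y. (\<lambda>n. inner ((W ^^ n) x) ((W ^^ n) y)) \<longlonglongrightarrow> b x y"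
    using asymptotic_form[OF W] by blast
  interpret b: bounded_bilinear b by fact
  have b_sym: "b x y = b y x" for x y
    using b[of x y] b[of y x] by (simp add: inner_commute LIMSEQ_unique)
  have b_le: "b x x \<le> (norm x)\<^sup>2" for x
    using norm_funpow_contraction_le[OF W(2), of _ x]
    by (intro LIMSEQ_le_const2[OF b]) (simp add: power_mono flip: power2_norm_eq_inner)
  have b_nonneg: "b x x \<ge> 0" for x
    by (rule LIMSEQ_le_const[OF b]) simp
  have b_W: "b (W x) (W x) = b x x" for x
    using b[of "W x" "W x"] LIMSEQ_Suc[OF b[of x x]]
    by (simp add: funpow_swap1[symmetric] LIMSEQ_unique)
  have b_gen: "b x y = 0" if "generates T x y" for x y
    using b_W[of "y - x"] cogen[OF that] b_sym[of x y]
    by (simp add: b.add_left b.add_right b.diff_left b.diff_right)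
  have zero: "b x x = 0" if xy: "generates T x y" for x y
  proof -
    have const: "b (T t x) (T t x) = b x x" if "t \<ge> 0" for t
    proof -
      have "b (T t x) (T t x) = b (T 0 x) (T 0 x)"
      proof (rule constant_if_right_derivative_0[where f = "\<lambda>t. b (T t x) (T t x)"])
        show "continuous_on {0..} (\<lambda>t. b (T t x) (T t x))"
          by (intro b.continuous_on C0_semigroupD(4)[OF C0])
        show "((\<lambda>t. b (T t x) (T t x)) has_vector_derivative 0) (at_right t)" if "t \<ge> 0" for t
          using b.has_vector_derivative[OF orbit_has_right_derivative[OF C0 xy that]
              orbit_has_right_derivative[OF C0 xy that]]
            b_gen[OF generates_orbit[OF C0 xy that]] b_sym[of "T t y"]
          by simp
      qed (rule that)
      then show ?thesis
        by (simp add: C0_semigroupD(2)[OF C0])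
    qed
    have "((\<lambda>t. (norm (T t x))\<^sup>2) \<longlongrightarrow> 0\<^sup>2) at_top"
      by (intro tendsto_intros stable)
    then have "b x x \<le> 0\<^sup>2"
    proof (rule tendsto_lowerbound)
      show "\<forall>\<^sub>F t in at_top. b x x \<le> (norm (T t x))\<^sup>2"
        using eventually_ge_at_top[of 0] by eventually_elim (metis const b_le)
    qed simp
    with b_nonneg[of x] show ?thesis by simp
  qed
  have "x \<in> {x. b x x = 0}"
  proof (rule in_closed_superset_of_generator_domain[OF C0])
    show "\<exists>z. generates T z (z + x)" for x
      using generator_minus_id_surj[OF C0 contr] .
    show "closed {x. b x x = 0}"
      by (intro closed_Collect_eq b.continuous_on continuous_intros)
  qed (use zero in auto)
  then have "(\<lambda>n. (norm ((W ^^ n) x))\<^sup>2) \<longlonglongrightarrow> 0"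
    using b[of x x] by (simp add: power2_norm_eq_inner)
  then have "(\<lambda>n. sqrt ((norm ((W ^^ n) x))\<^sup>2)) \<longlonglongrightarrow> sqrt 0"
    by (rule tendsto_real_sqrt)
  then show ?thesis
    by (simp add: tendsto_norm_zero_iff)
qed


section \<open>Parseval's identity for a semidefinite form\<close>

locale psd_form =
  fixes d :: "'a \<Rightarrow> 'a::complex_hilbert_space \<Rightarrow> complex"
  assumes add_left: "d (x + y) z = d x z + d y z"
    and scale_left: "d (c *\<^sub>C x) z = c * d x z"
    and hermitian: "d y x = cnj (d x y)"
    and nonneg: "0 \<le> Re (d x x)"
begin

lemma add_right: "d z (x + y) = d z x + d z y"
  using hermitian[of z "x + y"] hermitian[of z x] hermitian[of z y] by (simp add: add_left)

lemma scale_right: "d z (c *\<^sub>C x) = cnj c * d z x"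
  using hermitian[of z "c *\<^sub>C x"] hermitian[of z x] by (simp add: scale_left)

lemma diff_left: "d (x - y) z = d x z - d y z"
  using add_left[of "x - y" y z] by simp

lemma diff_right: "d z (x - y) = d z x - d z y"
  using add_right[of z "x - y" y] by simp

lemma diag_real: "d x x = of_real (Re (d x x))"
  using arg_cong[OF hermitian[of x x], of Im] by (simp add: complex_eq_iff)

lemma diag_diff_scale:
  "Re (d (x - c *\<^sub>C y) (x - c *\<^sub>C y)) =
     Re (d x x) - 2 * Re (cnj c * d x y) + (cmod c)\<^sup>2 * Re (d y y)"
proof -
  have "d (x - c *\<^sub>C y) (x - c *\<^sub>C y) =
      d x x - (cnj c * d x y + cnj (cnj c * d x y)) + (c * cnj c) * d y y"
    using hermitian[of y x]
    by (simp add: diff_left diff_right scale_left scale_right algebra_simps)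
  also have "c * cnj c = of_real ((cmod c)\<^sup>2)"
    by (rule complex_norm_square[symmetric])
  finally show ?thesis
    by (simp del: of_real_power)
qed

text \<open>
  The degenerate case of the Cauchy-Schwarz inequality: if \<open>d x y\<close> were nonzero, then along a
  line through \<open>x\<close> in the direction of \<open>y\<close> the form would be affine and not constant, hence negative
  somewhere.
\<close>

lemma null_vector:
  assumes "Re (d y y) = 0"
  shows "d x y = 0" "d y x = 0"
proof -
  show "d x y = 0"
  proof (rule ccontr)
    assume "d x y \<noteq> 0"
    define s where "s = (Re (d x x) + 1) / (2 * (cmod (d x y))\<^sup>2)"
    define c where "c = of_real s * d x y"
    have "cnj c * d x y = of_real (s * (cmod (d x y))\<^sup>2)"
      by (simp add: c_def complex_norm_square mult.commute del: of_real_power)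
    then have "0 \<le> Re (d x x) - 2 * (s * (cmod (d x y))\<^sup>2)"
      using nonneg[of "x - c *\<^sub>C y"] assms unfolding diag_diff_scale by (simp del: of_real_power)
    moreover have "2 * (s * (cmod (d x y))\<^sup>2) = Re (d x x) + 1"
      using \<open>d x y \<noteq> 0\<close> by (simp add: s_def)
    ultimately show False by simp
  qed
  then show "d y x = 0"
    using hermitian[of x y] by simp
qed

lemma diag_diff_null:
  assumes "Re (d y y) = 0"
  shows "Re (d (x - y) (x - y)) = Re (d x x)"
  using diag_diff_scale[of x 1 y] null_vector(1)[OF assms] assms by simp

end

text \<open>
  One step of the Cholesky elimination: the rank-one form generated by \<open>v\<close> is split off. If
  \<open>d v v = 0\<close>, the division by zero leaves the form unchanged, which is the right value, since then
  \<open>v\<close> is already a null vector.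
\<close>

definition schur_complement ::
  "('a \<Rightarrow> 'a::complex_hilbert_space \<Rightarrow> complex) \<Rightarrow> 'a \<Rightarrow> 'a \<Rightarrow> 'a \<Rightarrow> complex" where
  "schur_complement d v x y = d x y - d x v * d v y / d v v"

context psd_form
begin

lemma Re_schur_complement_diag:
  "Re (schur_complement d v x x) = Re (d x x) - (cmod (d x v))\<^sup>2 / Re (d v v)"
proof -
  have "d x v * d v x = of_real ((cmod (d x v))\<^sup>2)"
    using hermitian[of x v] by (simp only: complex_norm_square) simp
  then have "d x v * d v x / d v v = of_real ((cmod (d x v))\<^sup>2 / Re (d v v))"
    using diag_real[of v] by (metis of_real_divide)
  then show ?thesis
    by (simp add: schur_complement_def)
qed

text \<open>
  The scalar \<open>c\<close> is the coefficient of the projection of \<open>x\<close> onto \<open>v\<close>, so the Schur complement is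
  the form evaluated on what the projection leaves over. This gives semidefiniteness.
\<close>

lemma schur_complement_diag:
  "\<exists>c. Re (schur_complement d v x x) = Re (d (x - c *\<^sub>C v) (x - c *\<^sub>C v))"
proof (cases "Re (d v v) = 0")
  case True
  then show ?thesis
    by (intro exI[of _ 0]) (simp add: Re_schur_complement_diag)
next
  case False
  define c where "c = d x v / of_real (Re (d v v))"
  have "cnj c * d x v = of_real ((cmod (d x v))\<^sup>2 / Re (d v v))"
    by (simp add: c_def complex_norm_square mult.commute del: of_real_power)
  moreover have "(cmod c)\<^sup>2 * Re (d v v) = (cmod (d x v))\<^sup>2 / Re (d v v)"
    using False by (simp add: c_def norm_divide power_divide power2_eq_square)
  ultimately show ?thesis
    unfolding Re_schur_complement_diag
    by (intro exI[of _ c]) (simp add: diag_diff_scale del: of_real_power)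
qed

lemma psd_form_schur_complement: "psd_form (schur_complement d v)"
proof
  fix x y z and c :: complex
  show "schur_complement d v (x + y) z = schur_complement d v x z + schur_complement d v y z"
    by (simp add: schur_complement_def add_left add_divide_distrib algebra_simps)
  show "schur_complement d v (c *\<^sub>C x) z = c * schur_complement d v x z"
    by (simp add: schur_complement_def scale_left algebra_simps)
  show "schur_complement d v y x = cnj (schur_complement d v x y)"
    using hermitian[of x y] hermitian[of v y] hermitian[of x v] hermitian[of v v]
    by (simp add: schur_complement_def mult.commute)
  show "0 \<le> Re (schur_complement d v x x)"
    using schur_complement_diag[of v x] nonneg by auto
qed

lemma schur_complement_le: "Re (schur_complement d v x x) \<le> Re (d x x)"
  using nonneg[of v] by (simp add: Re_schur_complement_diag)

lemma schur_complement_null: "Re (schur_complement d v v v) = 0"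
proof -
  have "cmod (d v v) = Re (d v v)"
    using diag_real[of v] nonneg[of v] by (metis abs_of_nonneg norm_of_real)
  then show ?thesis
    unfolding Re_schur_complement_diag
    by (cases "Re (d v v) = 0") (simp_all add: power2_eq_square)
qed

end

text \<open>
  Cholesky elimination along a dense sequence takes the place of Gram-Schmidt orthonormalization:
  it acts on the form and so stays within the given space, null vectors included. The functional
  \<open>l n\<close> records what the \<open>n\<close>-th step removes from the form. After that step \<open>v n\<close> is a null vector, so
  the remaining form at \<open>x\<close> equals its value at \<open>x - v n\<close>, which is at most the squared norm of
  \<open>x - v n\<close>. By density nothing remains in the limit.
\<close>

lemma psd_form_parseval:
  fixes d :: "'a \<Rightarrow> 'a::complex_hilbert_space \<Rightarrow> complex" and v :: "nat \<Rightarrow> 'a"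
  assumes d: "psd_form d" and d_le: "\<And>x. Re (d x x) \<le> (norm x)\<^sup>2"
    and dense: "\<And>x e. e > 0 \<Longrightarrow> \<exists>n. norm (x - v n) < e"
  obtains l :: "nat \<Rightarrow> 'a \<Rightarrow> complex" where
    "\<And>n x y. l n (x + y) = l n x + l n y" "\<And>n c x. l n (c *\<^sub>C x) = c * l n x"
    "\<And>x. (\<lambda>n. (cmod (l n x))\<^sup>2) sums Re (d x x)"
proof -
  define D where "D = rec_nat d (\<lambda>n D. schur_complement D (v n))"
  have D_0: "D 0 = d" and D_Suc: "D (Suc n) = schur_complement (D n) (v n)" for n
    by (simp_all add: D_def)
  have psd: "psd_form (D n)" for n
    by (induction n) (simp_all add: D_0 D_Suc d psd_form.psd_form_schur_complement)
  define l where "l n x = D n x (v n) / of_real (sqrt (Re (D n (v n) (v n))))" for n x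
  show thesis
  proof
    show "l n (x + y) = l n x + l n y" for n x y
      by (simp add: l_def psd_form.add_left[OF psd] add_divide_distrib)
    show "l n (c *\<^sub>C x) = c * l n x" for n c x
      by (simp add: l_def psd_form.scale_left[OF psd])
    fix x
    have step: "(cmod (l n x))\<^sup>2 = Re (D n x x) - Re (D (Suc n) x x)" for n
      using psd_form.nonneg[OF psd, of n "v n"]
      by (simp add: D_Suc psd_form.Re_schur_complement_diag[OF psd] l_def norm_divide power_divide)
    have decreasing: "Re (D m y y) \<le> Re (D n y y)" if "n \<le> m" for n m y
      using that
    proof (rule lift_Suc_antimono_le[of "\<lambda>n. Re (D n y y)", rotated])
      show "Re (D (Suc n) y y) \<le> Re (D n y y)" for n
        by (simp add: D_Suc psd_form.schur_complement_le[OF psd])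
    qed
    have null: "Re (D m (v n) (v n)) = 0" if "n < m" for m n
      using decreasing[of "Suc n" m "v n"] that psd_form.nonneg[OF psd, of m "v n"]
        psd_form.schur_complement_null[OF psd, of n "v n"]
      by (simp add: D_Suc)
    have "(\<lambda>m. Re (D m x x)) \<longlonglongrightarrow> 0"
    proof (rule LIMSEQ_I)
      fix e :: real assume "e > 0"
      then obtain n where n: "norm (x - v n) < sqrt e"
        using dense[of "sqrt e"] by auto
      have "norm (Re (D m x x) - 0) < e" if "m \<ge> Suc n" for m
      proof -
        have "Re (D m x x) = Re (D m (x - v n) (x - v n))"
          using psd_form.diag_diff_null[OF psd null] that by simp
        also have "\<dots> \<le> Re (d (x - v n) (x - v n))"
          using decreasing[of 0 m] by (simp add: D_0)
        also have "\<dots> \<le> (norm (x - v n))\<^sup>2"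
          by (rule d_le)
        also have "\<dots> < (sqrt e)\<^sup>2"
          using n by (intro power_strict_mono) auto
        finally show ?thesis
          using psd_form.nonneg[OF psd, of m x] \<open>e > 0\<close> by simp
      qed
      then show "\<exists>n0. \<forall>m\<ge>n0. norm (Re (D m x x) - 0) < e" by blast
    qed
    from telescope_sums'[OF this] show "(\<lambda>n. (cmod (l n x))\<^sup>2) sums Re (d x x)"
      by (simp add: step D_0)
  qed
qed


section \<open>The backward shift as a universal model\<close>

text \<open>
  The half-line is cut into cells of positive measure, indexed by pairs \<open>(n, k)\<close>. Translation by
  \<open>1\<close> maps each row of cells, the interval \<open>(n, n + 1]\<close>, onto the next one, so the backward shift
  moves each row into the previous one and acts on functions that are constant on cells as a shift
  of infinite multiplicity. The infinitely many cells in a row supply the multiplicity.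
\<close>

definition cell :: "nat \<Rightarrow> nat \<Rightarrow> real set" where
  "cell n k = {n + 1 / (real k + 2)<..n + 1 / (real k + 1)}"

definition cell_row :: "real \<Rightarrow> nat" where
  "cell_row t = nat (\<lceil>t\<rceil> - 1)"

definition cell_col :: "real \<Rightarrow> nat" where
  "cell_col t = nat (\<lfloor>1 / (t - cell_row t)\<rfloor> - 1)"

text \<open>
  The function with coordinates \<open>c n k\<close> in the orthonormal system of normalized indicator functions
  of the cells: the square root is the inverse of the square root of the length of a cell.
\<close>

definition spread :: "(nat \<Rightarrow> nat \<Rightarrow> complex) \<Rightarrow> real \<Rightarrow> complex" where
  "spread c t = complex_of_real (sqrt ((real (cell_col t) + 1) * (real (cell_col t) + 2))) *
     c (cell_row t) (cell_col t)"

lemma cell_iff: "t \<in> cell n k \<longleftrightarrow> 0 < t \<and> cell_row t = n \<and> cell_col t = k"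
proof -
  (* The cells inside the unit interval are the level sets of the integer part of the reciprocal. *)
  have unit: "s \<in> {1 / (real k + 2)<..1 / (real k + 1)} \<longleftrightarrow> 0 < s \<and> \<lfloor>1 / s\<rfloor> = int k + 1" for s :: real
  proof (cases "0 < s")
    case True
    then have "\<lfloor>1 / s\<rfloor> = int k + 1 \<longleftrightarrow> real k + 1 \<le> 1 / s \<and> 1 / s < real k + 2"
      by (simp add: floor_eq_iff add.commute)
    with True show ?thesis
      by (auto simp: field_simps)
  next
    case False
    moreover have "0 < 1 / (real k + 2)" by simp
    ultimately have "s \<notin> {1 / (real k + 2)<..1 / (real k + 1)}"
      unfolding greaterThanAtMost_iff by linarith
    with False show ?thesis by blast
  qed
  have cell_row: "0 < t \<and> cell_row t = n \<longleftrightarrow> t - n \<in> {0<..1}"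
  proof -
    have "t - n \<in> {0<..1} \<longleftrightarrow> \<lceil>t\<rceil> = int n + 1"
      by (auto simp: ceiling_eq_iff)
    also have "\<dots> \<longleftrightarrow> 0 < t \<and> cell_row t = n"
      unfolding cell_row_def zero_less_ceiling[symmetric] by arith
    finally show ?thesis by simp
  qed
  have "t \<in> cell n k \<longleftrightarrow> t - n \<in> {1 / (real k + 2)<..1 / (real k + 1)}"
    by (auto simp: cell_def)
  also have "\<dots> \<longleftrightarrow> t - n \<in> {0<..1} \<and> t - n \<in> {1 / (real k + 2)<..1 / (real k + 1)}"
  proof -
    have "0 < 1 / (real k + 2)" "1 / (real k + 1) \<le> 1"
      by (simp_all add: divide_le_eq_1)
    then show ?thesis
      unfolding greaterThanAtMost_iff by (meson less_trans order_trans)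
  qed
  also have "\<dots> \<longleftrightarrow> 0 < t \<and> cell_row t = n \<and> 0 < t - cell_row t \<and> \<lfloor>1 / (t - cell_row t)\<rfloor> = int k + 1"
    unfolding unit using cell_row by auto
  also have "\<dots> \<longleftrightarrow> 0 < t \<and> cell_row t = n \<and> cell_col t = k"
  proof -
    have "0 < t - cell_row t \<and> 1 \<le> \<lfloor>1 / (t - cell_row t)\<rfloor>" if "0 < t" "cell_row t = n"
      using that cell_row by (auto simp: le_floor_iff)
    then show ?thesis
      by (auto simp: cell_col_def)
  qed
  finally show ?thesis .
qed

lemma cell_row_col_add_1:
  assumes "0 < t"
  shows "cell_row (t + 1) = Suc (cell_row t)" "cell_col (t + 1) = cell_col t"
proof -
  show "cell_row (t + 1) = Suc (cell_row t)"
    using assms by (simp add: cell_row_def Suc_nat_eq_nat_zadd1 nat_add_distrib)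
  then show "cell_col (t + 1) = cell_col t"
    by (simp add: cell_col_def)
qed

lemma measurable_cell_row [measurable]: "cell_row \<in> borel \<rightarrow>\<^sub>M count_space UNIV"
  unfolding cell_row_def[abs_def] by measurable

lemma measurable_cell_col [measurable]: "cell_col \<in> borel \<rightarrow>\<^sub>M count_space UNIV"
  unfolding cell_col_def[abs_def] by measurable

lemma borel_measurable_half_line:
  "f \<in> borel \<rightarrow>\<^sub>M M \<Longrightarrow> f \<in> half_line \<rightarrow>\<^sub>M M"
  by (intro measurable_restrict_space1 measurable_completion) simp

lemma nn_integral_cells:
  fixes g :: "nat \<Rightarrow> nat \<Rightarrow> ennreal"
  shows "(\<integral>\<^sup>+t. g (cell_row t) (cell_col t) \<partial>half_line) =
    (\<Sum>n. \<Sum>k. g n k * ennreal (1 / ((real k + 1) * (real k + 2))))"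
proof -
  have cell_sets [measurable]: "cell n k \<in> sets half_line" for n k
  proof -
    have "cell n k \<subseteq> {0<..}"
      by (auto simp: cell_iff)
    then show ?thesis
      by (auto simp: sets_restrict_space_iff cell_def)
  qed
  have cell_measure: "emeasure half_line (cell n k) = ennreal (1 / ((real k + 1) * (real k + 2)))" for n k
  proof -
    have "emeasure half_line (cell n k) = emeasure lebesgue (cell n k)"
      by (rule emeasure_restrict_space) (auto simp: cell_iff)
    also have "\<dots> = ennreal ((n + 1 / (real k + 1)) - (n + 1 / (real k + 2)))"
      unfolding cell_def by (simp add: frac_le add.commute)
    also have "(n + 1 / (real k + 1)) - (n + 1 / (real k + 2)) = 1 / ((real k + 1) * (real k + 2))"
      by (simp add: field_simps)
    finally show ?thesis .
  qed
  have "(\<integral>\<^sup>+t. g (cell_row t) (cell_col t) \<partial>half_line) =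
      (\<integral>\<^sup>+t. (\<Sum>n. \<Sum>k. g n k * indicator (cell n k) t) \<partial>half_line)"
  proof (rule nn_integral_cong)
    fix t assume "t \<in> space half_line"
    then have t: "0 < t" by simp
    have "(\<Sum>k. g n k * indicator (cell n k) t) = (if n = cell_row t then g n (cell_col t) else 0)" for n
      using suminf_finite[of "{cell_col t}" "\<lambda>k. g n k * indicator (cell n k) t"] t
      by (auto simp: cell_iff indicator_def)
    then show "g (cell_row t) (cell_col t) = (\<Sum>n. \<Sum>k. g n k * indicator (cell n k) t)"
      using suminf_finite[of "{cell_row t}" "\<lambda>n. if n = cell_row t then g n (cell_col t) else 0"] by simp
  qed
  also have "\<dots> = (\<Sum>n. \<integral>\<^sup>+t. (\<Sum>k. g n k * indicator (cell n k) t) \<partial>half_line)"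
    by (intro nn_integral_suminf) measurable
  also have "\<dots> = (\<Sum>n. \<Sum>k. \<integral>\<^sup>+t. g n k * indicator (cell n k) t \<partial>half_line)"
    by (intro suminf_cong nn_integral_suminf) measurable
  also have "\<dots> = (\<Sum>n. \<Sum>k. g n k * ennreal (1 / ((real k + 1) * (real k + 2))))"
    by (intro suminf_cong) (simp add: nn_integral_cmult_indicator cell_sets cell_measure)
  finally show ?thesis .
qed

lemma measurable_spread: "spread c \<in> borel_measurable half_line"
proof (rule borel_measurable_half_line)
  have "(\<lambda>t. (\<lambda>(n, k). of_real (sqrt ((real k + 1) * (real k + 2))) * c n k) (cell_row t, cell_col t))
      \<in> borel_measurable borel"
    by (rule measurable_compose[of _ _ "count_space UNIV"])
       (auto simp: pair_measure_countable[symmetric])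
  then show "spread c \<in> borel_measurable borel"
    by (simp add: spread_def[abs_def])
qed

lemma nn_integral_spread:
  "(\<integral>\<^sup>+t. ennreal ((cmod (spread c t))\<^sup>2) \<partial>half_line) =
     (\<Sum>n. \<Sum>k. ennreal ((cmod (c n k))\<^sup>2))"
proof -
  have "(\<integral>\<^sup>+t. ennreal ((cmod (spread c t))\<^sup>2) \<partial>half_line) =
      (\<integral>\<^sup>+t. (\<lambda>n k. ennreal ((real k + 1) * (real k + 2) * (cmod (c n k))\<^sup>2)) (cell_row t) (cell_col t) \<partial>half_line)"
    by (simp add: spread_def norm_mult power_mult_distrib)
  also have "\<dots> = (\<Sum>n. \<Sum>k. ennreal ((real k + 1) * (real k + 2) * (cmod (c n k))\<^sup>2) *
      ennreal (1 / ((real k + 1) * (real k + 2))))"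
    by (rule nn_integral_cells)
  also have "\<dots> = (\<Sum>n. \<Sum>k. ennreal ((cmod (c n k))\<^sup>2))"
  proof (intro suminf_cong)
    fix n k :: nat
    have "(real k + 1) * (real k + 2) * (cmod (c n k))\<^sup>2 * (1 / ((real k + 1) * (real k + 2))) = (cmod (c n k))\<^sup>2"
      by (simp add: add_nonneg_eq_0_iff)
    then show "ennreal ((real k + 1) * (real k + 2) * (cmod (c n k))\<^sup>2) *
        ennreal (1 / ((real k + 1) * (real k + 2))) = ennreal ((cmod (c n k))\<^sup>2)"
      by (simp flip: ennreal_mult)
  qed
  finally show ?thesis .
qed


text \<open>
  Let \<open>d\<close> be the defect form of \<open>W\<close>, the loss of inner product in one step, and \<open>l k\<close> its Parseval
  coordinates. The vector \<open>x\<close> is sent to the function whose \<open>n\<close>-th row has the coordinates of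
  \<open>W\<^sup>n x\<close>. The squared norm of the image is the sum of the successive losses of squared norm, which
  telescopes to the squared norm of \<open>x\<close> since \<open>W\<^sup>n x\<close> tends to \<open>0\<close>. Dropping the first row amounts to
  replacing \<open>x\<close> by \<open>W x\<close>.
\<close>

lemma contraction_embeds_in_backward_shift:
  fixes W :: "'a \<Rightarrow> 'a::complex_hilbert_space"
  assumes separable: "separable_space (euclidean :: 'a topology)"
    and W: "bounded_clinear W" and contr: "\<And>x. norm (W x) \<le> norm x"
    and stable: "\<And>x. (\<lambda>n. (W ^^ n) x) \<longlonglongrightarrow> 0"
  obtains J :: "'a \<Rightarrow> L2_half_line" where
    "bounded_clinear J" "\<And>x. norm (J x) = norm x" "\<And>x. J (W x) = backward_shift (J x)"
proof -
  have W_add: "W (x + y) = W x + W y" and W_scale: "W (c *\<^sub>C x) = c *\<^sub>C W x" for c x y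
    using W by (auto simp: bounded_clinear_on_def)
  have Wn_add: "(W ^^ n) (x + y) = (W ^^ n) x + (W ^^ n) y" for n x y
    by (induction n) (simp_all add: W_add)
  have Wn_scale: "(W ^^ n) (c *\<^sub>C x) = c *\<^sub>C (W ^^ n) x" for n c x
    by (induction n) (simp_all add: W_scale)

  define d where "d x y = cinner x y - cinner (W x) (W y)" for x y
  have d_diag: "Re (d x x) = (norm x)\<^sup>2 - (norm (W x))\<^sup>2" for x
    by (simp add: d_def cinner_self del: of_real_power)
  have d: "psd_form d"
  proof
    fix x y z and c :: complex
    show "d (x + y) z = d x z + d y z"
      by (simp add: d_def W_add cinner_add_left)
    show "d (c *\<^sub>C x) z = c * d x z"
      by (simp add: d_def W_scale cinner_scaleC_left algebra_simps)
    show "d y x = cnj (d x y)"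
      using cinner_commute[of y x] cinner_commute[of "W y" "W x"] by (simp add: d_def)
    show "0 \<le> Re (d x x)"
      by (simp add: d_diag contr power_mono)
  qed

  obtain v :: "nat \<Rightarrow> 'a" where v: "\<And>x e. e > 0 \<Longrightarrow> \<exists>n. norm (x - v n) < e"
  proof -
    obtain C :: "'a set" where C: "countable C" "closure C = UNIV"
      using separable by (auto simp: separable_space_def)
    then have "C \<noteq> {}"
      by auto
    have "\<exists>n. norm (x - from_nat_into C n) < e" if "e > 0" for x e
    proof -
      obtain y where "y \<in> C" "dist y x < e"
        using C(2) \<open>e > 0\<close> closure_approachable[of x C] by auto
      then show ?thesis
        using from_nat_into_surj[OF C(1)] by (metis dist_norm norm_minus_commute)
    qed
    then show thesis by (rule that)
  qed

  obtain l :: "nat \<Rightarrow> 'a \<Rightarrow> complex" where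
    l_add: "\<And>k x y. l k (x + y) = l k x + l k y" and
    l_scale: "\<And>k c x. l k (c *\<^sub>C x) = c * l k x" and
    l_sums: "\<And>x. (\<lambda>k. (cmod (l k x))\<^sup>2) sums Re (d x x)"
    using psd_form_parseval[OF d _ v] by (auto simp: d_diag)

  define f where "f x = spread (\<lambda>n k. l k ((W ^^ n) x))" for x
  have norm_f: "(\<integral>\<^sup>+t. ennreal ((cmod (f x t))\<^sup>2) \<partial>half_line) = ennreal ((norm x)\<^sup>2)" for x
  proof -
    have "(\<lambda>n. (norm ((W ^^ n) x))\<^sup>2) \<longlonglongrightarrow> 0\<^sup>2"
      by (intro tendsto_power tendsto_norm_zero stable)
    then have "(\<lambda>n. Re (d ((W ^^ n) x) ((W ^^ n) x))) sums (norm x)\<^sup>2"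
      using telescope_sums'[of "\<lambda>n. (norm ((W ^^ n) x))\<^sup>2" 0] by (simp add: d_diag)
    then have "(\<Sum>n. ennreal (Re (d ((W ^^ n) x) ((W ^^ n) x)))) = ennreal ((norm x)\<^sup>2)"
      by (intro suminf_ennreal_eq psd_form.nonneg[OF d])
    moreover have "(\<Sum>k. ennreal ((cmod (l k y))\<^sup>2)) = ennreal (Re (d y y))" for y
      by (intro suminf_ennreal_eq l_sums) simp
    ultimately show ?thesis
      by (simp add: f_def nn_integral_spread)
  qed
  have f: "square_integrable half_line (f x)" for x
    using norm_f[of x] measurable_spread
    by (simp add: square_integrable_def integrable_iff_bounded f_def)
  then have rel: "L2_rel (f x) (f x)" for x
    by (simp add: L2_rel_def)

  define J where "J x = abs_L2_half_line (f x)" for x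
  have J_add: "J (x + y) = J x + J y" for x y
  proof -
    have "f (x + y) = (\<lambda>t. f x t + f y t)"
      by (simp add: fun_eq_iff f_def spread_def Wn_add l_add distrib_left)
    then show ?thesis
      by (simp add: J_def plus_L2_half_line.abs_eq rel)
  qed
  have J_scale: "J (c *\<^sub>C x) = c *\<^sub>C J x" for c x
  proof -
    have "f (c *\<^sub>C x) = (\<lambda>t. c * f x t)"
      by (simp add: fun_eq_iff f_def spread_def Wn_scale l_scale)
    then show ?thesis
      by (simp add: J_def scaleC_L2_half_line.abs_eq rel)
  qed
  have J_norm: "norm (J x) = norm x" for x
  proof -
    have "ennreal ((norm (J x))\<^sup>2) = ennreal ((norm x)\<^sup>2)"
      unfolding J_def power2_norm_L2[OF f] by (rule norm_f)
    then show ?thesis by simp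
  qed
  show thesis
  proof
    show "bounded_clinear J"
      by (intro bounded_clinear_contractionI J_add J_scale) (simp add: J_norm)
    show "norm (J x) = norm x" for x
      by (rule J_norm)
    show "J (W x) = backward_shift (J x)" for x
    proof -
      have eq: "f (W x) t = f x (t + 1)" if "0 < t" for t
        using that by (simp add: f_def spread_def cell_row_col_add_1 funpow_swap1)
      have shift: "backward_shift (J x) = abs_L2_half_line (\<lambda>t. f x (t + 1))"
        by (simp add: J_def backward_shift.abs_eq rel)
      have "L2_rel (f (W x)) (\<lambda>t. f x (t + 1))"
        unfolding L2_rel_def using f eq by (auto intro!: square_integrable_translation AE_I2)
      then show ?thesis
        unfolding shift unfolding J_def by (rule Quotient_rel_abs[OF Quotient_L2_half_line])
    qed
  qed
qed

lemma backward_shift_contraction: "norm (backward_shift g) \<le> norm g"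
proof -
  have "norm (backward_shift (abs_L2_half_line f)) \<le> norm (abs_L2_half_line f)"
    if f: "L2_rel f f" for f
  proof -
    have sq: "square_integrable half_line f"
      using f by (simp add: L2_rel_def)
    have [measurable]: "f \<in> borel_measurable half_line"
      using sq by (rule square_integrable_measurable)
    let ?g = "\<lambda>t. ennreal ((cmod (f t))\<^sup>2) * indicator {0<..} t"
    have "(\<lambda>t. ennreal ((cmod (f t))\<^sup>2)) \<in> borel_measurable half_line"
      by measurable
    then have g: "?g \<in> borel_measurable lebesgue"
      by (subst (asm) borel_measurable_restrict_space_iff_ennreal) auto
    have "ennreal ((norm (backward_shift (abs_L2_half_line f)))\<^sup>2) =
        (\<integral>\<^sup>+t. ennreal ((cmod (f (t + 1)))\<^sup>2) \<partial>half_line)"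
      using sq f by (simp add: backward_shift.abs_eq power2_norm_L2 square_integrable_translation)
    also have "\<dots> \<le> (\<integral>\<^sup>+t. ?g (1 + 1 * t) \<partial>lebesgue)"
      by (subst nn_integral_restrict_space)
         (auto intro!: nn_integral_mono simp: indicator_def add.commute)
    also have "\<dots> = (\<integral>\<^sup>+t. ?g t \<partial>lebesgue)"
      using nn_integral_real_affine_lebesgue[OF g, of 1 1] by simp
    also have "\<dots> = ennreal ((norm (abs_L2_half_line f))\<^sup>2)"
      by (subst nn_integral_restrict_space[symmetric]) (auto simp: power2_norm_L2 sq)
    finally show ?thesis
      by (auto intro: power2_le_imp_le)
  qed
  then show ?thesis
    using L2_half_line.abs_induct[of "\<lambda>g. norm (backward_shift g) \<le> norm g"] by blast
qed


section \<open>Intertwining the semigroups\<close>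

lemma generates_has_cogenerator:
  assumes "has_cogenerator U V" "generates U x y"
  shows "V (y - x) = y + x"
proof -
  have "bij_betw (\<lambda>x. generator U x - 1 *\<^sub>C x) (generator_domain U) UNIV"
    using assms(1) by (simp add: has_cogenerator_def op_spectrum_def op_resolvent_set_def)
  then have "inj_on (\<lambda>x. generator U x - x) (generator_domain U)"
    by (simp add: bij_betw_def)
  moreover have "x \<in> generator_domain U" "generator U x = y"
    using assms(2) by (auto simp: generates_iff)
  ultimately have "inv_into (generator_domain U) (\<lambda>x. generator U x - x) (y - x) = x"
    by (metis (no_types, lifting) inv_into_f_f)
  then have "cogenerator U (y - x) = y + x"
    using \<open>generator U x = y\<close> by (simp add: cogenerator_def)
  then show ?thesis
    using assms(1) by (simp add: has_cogenerator_def)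
qed

lemma has_cogenerator_surj:
  assumes "has_cogenerator U V"
  shows "\<exists>x y. generates U x y \<and> y - x = z"
proof -
  have "(\<lambda>x. generator U x - 1 *\<^sub>C x) ` generator_domain U = UNIV"
    using assms by (simp add: has_cogenerator_def op_spectrum_def op_resolvent_set_def bij_betw_def)
  then obtain x where "x \<in> generator_domain U" "generator U x - x = z"
    by (metis (no_types, lifting) UNIV_I complex_vector.scale_one imageE)
  then show ?thesis
    by (auto simp: generates_iff)
qed

lemma dissipative_if_contractive_cogenerator:
  assumes "has_cogenerator U V" "\<And>x. norm (V x) \<le> norm x" "generates U x y"
  shows "inner y x \<le> 0"
proof -
  have "norm (y + x) \<le> norm (y - x)"
    using assms(2)[of "y - x"] generates_has_cogenerator[OF assms(1,3)] by simp
  then have "(norm (y + x))\<^sup>2 \<le> (norm (y - x))\<^sup>2"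
    by (rule power_mono) simp
  then show ?thesis
    by (simp add: power2_norm_eq_inner inner_simps inner_commute)
qed

text \<open>
  The relation \<open>V (y - x) = y + x\<close> determines a point of the graph of the generator from \<open>y - x\<close>
  alone, so a map that intertwines the cogenerators carries the one graph into the other.
\<close>

lemma intertwines_generators:
  assumes U: "has_cogenerator U V"
    and W: "\<And>x y. generates T x y \<Longrightarrow> W (y - x) = y + x"
    and J: "linear J" "\<And>x. J (W x) = V (J x)"
    and xy: "generates T x y"
  shows "generates U (J x) (J y)"
proof -
  obtain x' y' where x'y': "generates U x' y'" "y' - x' = J (y - x)"
    using has_cogenerator_surj[OF U] by blast
  have "y' + x' = V (y' - x')"
    using generates_has_cogenerator[OF U x'y'(1)] by simp
  also have "\<dots> = J (W (y - x))"
    by (simp add: x'y'(2) J(2))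
  also have "\<dots> = J y + J x"
    by (simp add: W[OF xy] linear_add[OF J(1)])
  finally have sum: "y' + x' = J y + J x" .
  have diff: "y' - x' = J y - J x"
    by (simp add: x'y'(2) linear_diff[OF J(1)])
  have "2 *\<^sub>R x' = (y' + x') - (y' - x')" "2 *\<^sub>R y' = (y' + x') + (y' - x')"
    by (simp_all add: scaleR_2)
  then have "2 *\<^sub>R x' = 2 *\<^sub>R J x" "2 *\<^sub>R y' = 2 *\<^sub>R J y"
    by (simp_all only: sum diff) (simp_all add: scaleR_2)
  then have "x' = J x" "y' = J y"
    by simp_all
  with x'y' show ?thesis by simp
qed

text \<open>
  For \<open>x\<close> in the domain, the difference \<open>u\<close> of the two orbits starts at \<open>0\<close> and satisfies
  \<open>u' = A u\<close> with the dissipative generator \<open>A\<close> of \<open>U\<close>, so the norm of \<open>u\<close> cannot grow. Density of the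
  domain does the rest.
\<close>

lemma intertwines_semigroups:
  assumes U: "C0_semigroup U" and dissipative: "\<And>x y. generates U x y \<Longrightarrow> inner y x \<le> 0"
    and T: "C0_semigroup T" and surj: "\<And>x. \<exists>z. generates T z (z + x)"
    and J: "bounded_linear J" "\<And>x y. generates T x y \<Longrightarrow> generates U (J x) (J y)"
    and "t \<ge> 0"
  shows "U t (J x) = J (T t x)"
proof -
  have on_domain: "U t (J x) = J (T t x)" if xy: "generates T x y" for x y
  proof -
    define u where "u s = J (T s x) - U s (J x)" for s
    have u_cont: "continuous_on {0..} u"
      unfolding u_def
      by (intro continuous_on_diff C0_semigroupD(4)[OF U]
          bounded_linear.continuous_on[OF J(1)] C0_semigroupD(4)[OF T])
    have "(norm (u t))\<^sup>2 \<le> (norm (u 0))\<^sup>2"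
    proof (rule nonincreasing_if_right_derivative_le_0[OF _ _ \<open>t \<ge> 0\<close>])
      show "continuous_on {0..} (\<lambda>s. (norm (u s))\<^sup>2)"
        by (intro continuous_intros u_cont)
      fix s :: real assume "s \<ge> 0"
      define u' where "u' = J (T s y) - U s (J y)"
      have gen: "generates U (u s) u'"
        unfolding u_def u'_def using xy \<open>s \<ge> 0\<close>
        by (intro generates_diff[OF U] generates_orbit[OF U] generates_orbit[OF T] J(2))
      have "(u has_vector_derivative u') (at_right s)"
        unfolding u_def u'_def using xy \<open>s \<ge> 0\<close>
        by (intro has_vector_derivative_diff bounded_linear.has_vector_derivative[OF J(1)]
            orbit_has_right_derivative[OF T] orbit_has_right_derivative[OF U] J(2))
      then have "((\<lambda>s. inner (u s) (u s)) has_vector_derivative inner (u s) u' + inner u' (u s))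
          (at_right s)"
        by (intro bounded_bilinear.has_vector_derivative[OF bounded_bilinear_inner])
      moreover have "inner (u s) u' + inner u' (u s) \<le> 0"
        using dissipative[OF gen] by (simp add: inner_commute)
      ultimately show "\<exists>D\<le>0. ((\<lambda>s. (norm (u s))\<^sup>2) has_vector_derivative D) (at_right s)"
        unfolding power2_norm_eq_inner by blast
    qed
    then show ?thesis
      by (simp add: u_def C0_semigroupD(2)[OF T] C0_semigroupD(2)[OF U])
  qed
  have "x \<in> {x. U t (J x) = J (T t x)}"
  proof (rule in_closed_superset_of_generator_domain[OF T surj])
    have "bounded_linear (\<lambda>x. U t (J x))" "bounded_linear (\<lambda>x. J (T t x))"
      using C0_semigroup_bounded_linear[OF U \<open>t \<ge> 0\<close>] C0_semigroup_bounded_linear[OF T \<open>t \<ge> 0\<close>] J(1)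
      by (blast intro: bounded_linear_compose)+
    then show "closed {x. U t (J x) = J (T t x)}"
      by (intro closed_Collect_eq linear_continuous_on)
  qed (use on_domain in blast)
  then show ?thesis by simp
qed

theorem theorem3p5:
  fixes U :: "real \<Rightarrow> L2_half_line \<Rightarrow> L2_half_line"
    and T :: "real \<Rightarrow> 'k::complex_hilbert_space \<Rightarrow> 'k"
  assumes "C0_semigroup U"
    and "has_cogenerator U backward_shift"
    and "separable_space (euclidean :: 'k topology)"
    and "infinite_dimensional TYPE('k)"
    and "C0_dot_contraction_semigroup T"
  shows "\<exists>(M :: L2_half_line set) (R :: L2_half_line \<Rightarrow> 'k).
      closed M \<and> complex_vector.subspace M \<and> (\<forall>t\<ge>0. U t ` M \<subseteq> M) \<and>
      bounded_linear_isomorphism M UNIV R \<and>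
      (\<forall>t\<ge>0. \<forall>x. T t x = R (U t (inv_into M R x)))"
proof -
  note U = \<open>C0_semigroup U\<close> \<open>has_cogenerator U backward_shift\<close>
  have T: "C0_semigroup T" and T_contr: "\<And>t x. t \<ge> 0 \<Longrightarrow> norm (T t x) \<le> norm x"
    using assms(5) by (auto simp: C0_dot_contraction_semigroup_def)
  obtain W where W: "bounded_clinear W" "\<And>x. norm (W x) \<le> norm x"
    "\<And>x y. generates T x y \<Longrightarrow> W (y - x) = y + x"
    using exists_cogenerator[OF T T_contr] by blast
  have "(\<lambda>n. (W ^^ n) x) \<longlonglongrightarrow> 0" for x
    using assms(5) bounded_linear.linear[OF bounded_clinear_imp_bounded_linear[OF W(1)]] W(2,3)
    by (rule cogenerator_strongly_stable)
  with assms(3) W(1,2) obtain J :: "'k \<Rightarrow> L2_half_line" where J: "bounded_clinear J"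
    "\<And>x. norm (J x) = norm x" "\<And>x. J (W x) = backward_shift (J x)"
    using contraction_embeds_in_backward_shift by blast
  interpret J: bounded_linear J
    using J(1) by (rule bounded_clinear_imp_bounded_linear)
  have UJ: "U t (J x) = J (T t x)" if "t \<ge> 0" for t x
  proof (rule intertwines_semigroups[OF U(1) _ T _ J.bounded_linear_axioms _ that])
    show "inner y x \<le> 0" if "generates U x y" for x y
      using U(2) backward_shift_contraction that by (rule dissipative_if_contractive_cogenerator)
    show "\<exists>z. generates T z (z + x)" for x
      using generator_minus_id_surj[OF T T_contr] .
    show "generates U (J x) (J y)" if "generates T x y" for x y
      using U(2) W(3) J.linear_axioms J(3) that by (rule intertwines_generators)
  qed

  have "inj J"
    by (rule injI) (metis J(2) J.diff eq_iff_diff_eq_0 norm_eq_zero)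
  define M where "M = range J"
  define R where "R = inv J"
  have RJ: "R (J x) = x" for x
    using \<open>inj J\<close> by (simp add: R_def)
  have bij: "bij_betw R M UNIV"
    unfolding M_def by (rule bij_betw_byWitness[where f' = J]) (auto simp: RJ)
  have inv_R: "inv_into M R x = J x" for x
    by (rule inv_into_f_eq) (use bij in \<open>auto simp: bij_betw_def M_def RJ\<close>)
  show ?thesis
  proof (intro exI conjI allI impI)
    have "complete M"
      unfolding M_def
      by (rule complete_isometric_image[where e = 1])
         (auto simp: J(2) J.bounded_linear_axioms complete_UNIV subspace_UNIV)
    then show "closed M"
      by (rule complete_imp_closed)
    show "complex_vector.subspace M"
    proof (rule complex_vector.subspaceI)
      show "0 \<in> M"
        using J.zero by (metis M_def rangeI)
      show "a + b \<in> M" if "a \<in> M" "b \<in> M" for a b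
        using that by (auto simp: M_def simp flip: J.add)
      show "c *\<^sub>C a \<in> M" if "a \<in> M" for c a
        using that by (auto simp: M_def simp flip: bounded_clinear_scaleC[OF J(1)])
    qed
    show "U t ` M \<subseteq> M" if "t \<ge> 0" for t
      by (auto simp: M_def UJ[OF that])
    have "bounded_clinear_on M R"
      by (auto simp: bounded_clinear_on_def M_def RJ J(2)
          simp flip: J.add bounded_clinear_scaleC[OF J(1)] intro!: exI[of _ 1])
    moreover have "inv_into M R = J"
      using inv_R by blast
    ultimately show "bounded_linear_isomorphism M UNIV R"
      using bij J(1) by (simp add: bounded_linear_isomorphism_def)
    show "T t x = R (U t (inv_into M R x))" if "t \<ge> 0" for t x
      by (simp add: inv_R UJ[OF that] RJ)
  qed
qed

end
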